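(* Let $n$ and $h$ be positive integers and put $m=\operatorname{lcm}(n,h)$. Suppose that a $\mathrm{BH}(\mathbb{Z}_n,h)$ matrix exists. Assume moreover that for every prime divisor $p$ of $n$: (i) $p$ divides $h$, and (ii) for every prime divisor $q\neq p$ of $n$, $q^{\operatorname{ord}_{\widetilde{m}_q}(q)}\not\equiv 1 \pmod{p^{\nu_p(h)+1}}$. Then $n\leq \gcd(h,n)^2$.
   Context: For a finite abelian group $(G,+)$ and a positive integer $h$, a $\mathrm{BH}(G,h)$ matrix is a $|G|\times|G|$ matrix $H=(a_{g,k})_{g,k\in G}$ whose entries are complex $h$th roots of unity, which is $G$-invariant (i.e. $a_{g+l,k+l}=a_{g,k}$ for all $g,k,l\in G$), and satisfies $HH^*=|G|I$, where $H^*$ is the conjugate transpose. $\mathbb{Z}_n$ is the cyclic group of order $n$. $\nu_p(x)$ is the $p$-adic valuation of $x$; for coprime integers $a,N$, $\operatorname{ord}_N(a)$ is the least positive $j$ with $a^j\equiv 1\pmod N$. Writing the prime factorization $m=\prod_{i=1}^t p_i^{c_i}$, for a prime divisor $q$ of $n$ define $\widetilde{m}_q=\prod_{p_i\neq q}p_i$ if $m$ is odd or $q=2$, and $\widetilde{m}_q=4\prod_{p_i\neq 2,q}p_i$ otherwise. *)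

theory Defs
  imports "HOL-Number_Theory.Number_Theory" "HOL-Algebra.Elementary_Groups" Complex_Main
begin

text \<open>The group is written multiplicatively, as in HOL-Algebra. A matrix indexed by \<open>G\<close> is a
  function of two arguments, of which only the values on the carrier matter; the last conjunct
  is the entrywise form of \<open>H H\<^sup>* = |G| I\<close>.\<close>

definition BH_matrix ::
    "('g, 'r) monoid_scheme \<Rightarrow> nat \<Rightarrow> ('g \<Rightarrow> 'g \<Rightarrow> complex) \<Rightarrow> bool" where
  "BH_matrix G h a \<longleftrightarrow>
     comm_group G \<and> finite (carrier G) \<and> h > 0 \<and>
     (\<forall>g\<in>carrier G. \<forall>k\<in>carrier G. a g k ^ h = 1) \<and>
     (\<forall>g\<in>carrier G. \<forall>k\<in>carrier G. \<forall>l\<in>carrier G.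
        a (g \<otimes>\<^bsub>G\<^esub> l) (k \<otimes>\<^bsub>G\<^esub> l) = a g k) \<and>
     (\<forall>g\<in>carrier G. \<forall>k\<in>carrier G.
        (\<Sum>l\<in>carrier G. a g l * cnj (a k l)) = (if g = k then of_nat (order G) else 0))"

definition mtilde :: "nat \<Rightarrow> nat \<Rightarrow> nat" where
  "mtilde m q =
     (if odd m \<or> q = 2 then \<Prod>(prime_factors m - {q})
      else 4 * \<Prod>(prime_factors m - {2, q}))"

end

theory Submission
  imports Defs "HOL-Computational_Algebra.Computational_Algebra"
begin

text \<open>
  The first column of the matrix is a sequence \<open>c\<close> of \<open>h\<close>th roots of unity, and
  \<open>X = \<Sum> c\<^sub>u \<zeta>\<^sub>n\<^sup>u\<close> is an integer of the \<open>m\<close>th cyclotomic field with \<open>|X|\<^sup>2 = n\<close>. Put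
  \<open>r = n / gcd(h,n) = m / h\<close>. For each divisor \<open>k\<close> of \<open>r\<close>, the terms of a single residue class of
  \<open>u\<close> modulo \<open>k\<close> turn out to have a sum whose absolute value is still \<open>\<surd>n\<close>; for \<open>k = r\<close> these are only
  \<open>gcd(h,n)\<close> terms of absolute value 1, so \<open>n \<le> gcd(h,n)\<^sup>2\<close>.

  To pass from \<open>k\<close> to \<open>kp\<close>, multiply the partial sum by a root of unity to get an element \<open>Y\<close> of the
  \<open>M\<close>th cyclotomic ring, \<open>M = m/k\<close>, and let \<open>\<sigma>\<close> raise \<open>\<zeta>\<^sub>M\<close> to the power \<open>1 + M/p\<close>, which fixes the
  \<open>c\<^sub>u\<close>. Condition (ii) ensures that for each prime \<open>q\<close> dividing \<open>n\<close>, \<open>\<sigma>\<close> is a power of the Frobenius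
  of \<open>q\<close> on the part of the field unramified at \<open>q\<close>, so \<open>\<sigma>\<close> fixes the prime ideals above \<open>n\<close>. Hence
  \<open>\<sigma>(Y)/Y\<close> is a unit all of whose conjugates have absolute value 1, which is a root of unity \<open>\<epsilon>\<close> by
  Kronecker's theorem. As \<open>\<sigma>\<close> has order \<open>p\<close>, in general \<open>\<epsilon>\<^sup>p = 1\<close>, and \<open>Y\<close> lies in an eigenspace of
  \<open>\<sigma>\<close>, which is spanned by the terms of one residue class modulo \<open>p\<close>. The exception \<open>p = 2\<close>,
  \<open>\<epsilon> = \<plusminus>i\<close> forces \<open>n\<close> to be a power of 2 with \<open>n \<le> 8\<close>, and the autocorrelations of \<open>c\<close> exclude \<open>n = 8\<close>.
\<close>

section \<open>The ring \<open>\<int>[w]\<close> and its principal ideals\<close>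

definition ipoly :: "int poly \<Rightarrow> 'a::comm_ring_1 \<Rightarrow> 'a" where
  "ipoly P z = poly (map_poly of_int P) z"

lemma ipoly_0 [simp]: "ipoly 0 z = 0"
  by (simp add: ipoly_def)

lemma ipoly_pCons [simp]: "ipoly (pCons a P) z = of_int a + z * ipoly P z"
  by (simp add: ipoly_def map_poly_pCons)

lemma ipoly_1 [simp]: "ipoly 1 z = 1"
  by (simp add: one_pCons)

lemma ipoly_add [simp]: "ipoly (P + Q) z = ipoly P z + ipoly Q z"
proof (induction P arbitrary: Q)
  case (pCons a P)
  then show ?case by (cases Q) (simp add: algebra_simps)
qed simp

lemma ipoly_uminus [simp]: "ipoly (- P) z = - ipoly P z"
  by (induction P) (simp_all add: algebra_simps)

lemma ipoly_diff [simp]: "ipoly (P - Q) z = ipoly P z - ipoly Q z"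
  using ipoly_add[of P "- Q" z] by simp

lemma ipoly_smult [simp]: "ipoly (smult a P) z = of_int a * ipoly P z"
  by (induction P) (simp_all add: algebra_simps)

lemma ipoly_mult [simp]: "ipoly (P * Q) z = ipoly P z * ipoly Q z"
  by (induction P) (simp_all add: algebra_simps)

lemma ipoly_prod [simp]: "ipoly (\<Prod>i\<in>A. P i) z = (\<Prod>i\<in>A. ipoly (P i) z)"
  by (induction A rule: infinite_finite_induct) simp_all

lemma ipoly_monom [simp]: "ipoly (monom a k) z = of_int a * z ^ k"
  by (induction k) (simp_all add: monom_Suc monom_0 algebra_simps)

lemma ipoly_altdef: "ipoly P z = (\<Sum>i\<le>degree P. of_int (coeff P i) * z ^ i)"
  by (induction P) (simp_all add: sum.atMost_Suc_shift sum_distrib_left mult_ac del: sum.atMost_Suc)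

definition int_adjoin :: "'a::comm_ring_1 \<Rightarrow> 'a set" where
  "int_adjoin w = range (\<lambda>P. ipoly P w)"

lemma ipoly_in_int_adjoin [intro, simp]: "ipoly P w \<in> int_adjoin w"
  by (simp add: int_adjoin_def)

lemma int_adjoinE:
  assumes "x \<in> int_adjoin w"
  obtains P where "x = ipoly P w"
  using assms by (auto simp: int_adjoin_def)

lemma int_adjoin_self [intro, simp]: "w \<in> int_adjoin w"
  using ipoly_in_int_adjoin[of "[:0, 1:]" w] by simp

lemma int_adjoin_of_int [intro, simp]: "of_int a \<in> int_adjoin w"
  using ipoly_in_int_adjoin[of "[:a:]" w] by simp

lemma int_adjoin_0 [intro, simp]: "0 \<in> int_adjoin w"
  using int_adjoin_of_int[of 0 w] by simp

lemma int_adjoin_1 [intro, simp]: "1 \<in> int_adjoin w"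
  using int_adjoin_of_int[of 1 w] by simp

lemma int_adjoin_of_nat [intro, simp]: "of_nat a \<in> int_adjoin w"
  using int_adjoin_of_int[of "int a" w] by simp

lemma int_adjoin_add [intro, simp]:
  "x \<in> int_adjoin w \<Longrightarrow> y \<in> int_adjoin w \<Longrightarrow> x + y \<in> int_adjoin w"
  by (auto elim!: int_adjoinE simp flip: ipoly_add)

lemma int_adjoin_diff [intro, simp]:
  "x \<in> int_adjoin w \<Longrightarrow> y \<in> int_adjoin w \<Longrightarrow> x - y \<in> int_adjoin w"
  by (auto elim!: int_adjoinE simp flip: ipoly_diff)

lemma int_adjoin_uminus [intro, simp]: "x \<in> int_adjoin w \<Longrightarrow> - x \<in> int_adjoin w"
  using int_adjoin_diff[of 0 w x] by simp

lemma int_adjoin_mult [intro, simp]: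
  "x \<in> int_adjoin w \<Longrightarrow> y \<in> int_adjoin w \<Longrightarrow> x * y \<in> int_adjoin w"
  by (auto elim!: int_adjoinE simp flip: ipoly_mult)

lemma int_adjoin_power [intro, simp]: "x \<in> int_adjoin w \<Longrightarrow> x ^ k \<in> int_adjoin w"
  by (induction k) auto

lemma int_adjoin_sum [intro, simp]:
  "(\<And>i. i \<in> A \<Longrightarrow> f i \<in> int_adjoin w) \<Longrightarrow> (\<Sum>i\<in>A. f i) \<in> int_adjoin w"
  by (induction A rule: infinite_finite_induct) auto

lemma int_adjoin_ipoly [intro, simp]: "v \<in> int_adjoin w \<Longrightarrow> ipoly P v \<in> int_adjoin w"
  by (induction P) auto

definition pideal :: "'a::comm_ring_1 \<Rightarrow> 'a \<Rightarrow> 'a set" where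
  "pideal w d = (\<lambda>r. d * r) ` int_adjoin w"

lemma pidealI [intro]: "r \<in> int_adjoin w \<Longrightarrow> d * r \<in> pideal w d"
  by (auto simp: pideal_def)

lemma pidealE:
  assumes "x \<in> pideal w d"
  obtains r where "r \<in> int_adjoin w" "x = d * r"
  using assms by (auto simp: pideal_def)

lemma pideal_0 [simp]: "0 \<in> pideal w d"
  using pidealI[of 0 w d] by simp

lemma pideal_self [simp]: "d \<in> pideal w d"
  using pidealI[of 1 w d] by simp

lemma pideal_1 [simp]: "pideal w 1 = int_adjoin w"
  by (simp add: pideal_def)

lemma pideal_add: "x \<in> pideal w d \<Longrightarrow> y \<in> pideal w d \<Longrightarrow> x + y \<in> pideal w d"
  by (auto elim!: pidealE intro!: pidealI simp flip: distrib_left)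

lemma pideal_diff: "x \<in> pideal w d \<Longrightarrow> y \<in> pideal w d \<Longrightarrow> x - y \<in> pideal w d"
  by (auto elim!: pidealE intro!: pidealI simp flip: right_diff_distrib)

lemma pideal_mult_left: "x \<in> pideal w d \<Longrightarrow> r \<in> int_adjoin w \<Longrightarrow> r * x \<in> pideal w d"
  by (auto elim!: pidealE intro!: pidealI simp: mult.left_commute[of r d])

lemma pideal_mult_right: "x \<in> pideal w d \<Longrightarrow> r \<in> int_adjoin w \<Longrightarrow> x * r \<in> pideal w d"
  using pideal_mult_left[of x w d r] by (simp add: mult.commute)

lemma pideal_sum: "(\<And>i. i \<in> A \<Longrightarrow> f i \<in> pideal w d) \<Longrightarrow> (\<Sum>i\<in>A. f i) \<in> pideal w d"
  by (induction A rule: infinite_finite_induct) (auto intro: pideal_add)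

lemma pideal_mult: "x \<in> pideal w d \<Longrightarrow> y \<in> pideal w e \<Longrightarrow> x * y \<in> pideal w (d * e)"
proof (elim pidealE)
  fix r s assume "r \<in> int_adjoin w" "x = d * r" "s \<in> int_adjoin w" "y = e * s"
  then have "d * e * (r * s) \<in> pideal w (d * e)" "x * y = d * e * (r * s)" by auto
  then show ?thesis by simp
qed

lemma pideal_power: "x \<in> pideal w d \<Longrightarrow> x ^ k \<in> pideal w (d ^ k)"
  by (induction k) (auto intro: pideal_mult)

lemma pideal_prod:
  "(\<And>i. i \<in> A \<Longrightarrow> f i \<in> pideal w (g i)) \<Longrightarrow> (\<Prod>i\<in>A. f i) \<in> pideal w (\<Prod>i\<in>A. g i)"
  by (induction A rule: infinite_finite_induct) (auto intro: pideal_mult)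

lemma pideal_trans: "x \<in> pideal w d \<Longrightarrow> d \<in> pideal w e \<Longrightarrow> x \<in> pideal w e"
proof (elim pidealE)
  fix r s assume "r \<in> int_adjoin w" "x = d * r" "s \<in> int_adjoin w" "d = e * s"
  then have "e * (s * r) \<in> pideal w e" "x = e * (s * r)" by auto
  then show ?thesis by simp
qed

lemma pideal_cancel:
  fixes c :: "'a::idom"
  assumes "c * x \<in> pideal w (c * d)" "c \<noteq> 0"
  shows "x \<in> pideal w d"
proof -
  obtain r where "r \<in> int_adjoin w" "c * x = c * d * r" using assms(1) by (elim pidealE)
  then have "x = d * r" using assms(2) by simp
  then show ?thesis using \<open>r \<in> int_adjoin w\<close> by auto
qed

lemma pideal_of_int: "a dvd b \<Longrightarrow> of_int b \<in> pideal w (of_int a)"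
  by (elim dvdE) (simp add: pidealI)

lemma pideal_of_nat: "a dvd b \<Longrightarrow> of_nat b \<in> pideal w (of_nat a)"
  by (elim dvdE) (simp add: pidealI)

lemma one_minus_power_in_pideal:
  assumes "x \<in> int_adjoin w"
  shows "1 - x ^ j \<in> pideal w (1 - x)"
  unfolding one_diff_power_eq using assms by (intro pidealI) auto

lemma pideal_coprime_mult:
  assumes "x \<in> pideal w (of_nat a)" "x \<in> pideal w (of_nat b)" "coprime a b"
  shows "x \<in> pideal w (of_nat (a * b))"
proof -
  obtain s t :: int where bezout: "s * int a + t * int b = 1"
    using assms(3) bezout_int[of "int a" "int b"] by auto
  have "of_nat a * (of_int s * x) \<in> pideal w (of_nat a * of_nat b)"
       "of_nat b * (of_int t * x) \<in> pideal w (of_nat b * of_nat a)"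
    by (intro pideal_mult pideal_self pideal_mult_left assms int_adjoin_of_int)+
  then have "of_nat a * (of_int s * x) + of_nat b * (of_int t * x) \<in> pideal w (of_nat (a * b))"
    by (intro pideal_add) (auto simp: mult.commute)
  moreover have "of_nat a * (of_int s * x) + of_nat b * (of_int t * x)
      = of_int (s * int a + t * int b) * x"
    by (simp add: algebra_simps)
  ultimately show ?thesis by (simp add: bezout)
qed

lemma pideal_prime_powersI:
  assumes "n > 0" "x \<in> int_adjoin w"
    and "\<And>q. prime q \<Longrightarrow> q dvd n \<Longrightarrow> x \<in> pideal w (of_nat (q ^ multiplicity q n))"
  shows "x \<in> pideal w (of_nat n)"
proof -
  have "x \<in> pideal w (of_nat (\<Prod>q\<in>Q. q ^ multiplicity q n))"
    if "finite Q" "Q \<subseteq> prime_factors n" for Q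
    using that
  proof (induction Q rule: finite_induct)
    case empty
    then show ?case using assms(2) by simp
  next
    case (insert q Q)
    have "prime q" "q dvd n" using insert by (auto simp: prime_factors_dvd)
    moreover have "coprime (q ^ multiplicity q n) (\<Prod>q\<in>Q. q ^ multiplicity q n)"
    proof (rule prod_coprime_right)
      fix i assume "i \<in> Q"
      then have "prime i" "i \<noteq> q" using insert by (auto simp: prime_factors_dvd)
      then show "coprime (q ^ multiplicity q n) (i ^ multiplicity i n)"
        using \<open>prime q\<close> by (simp add: primes_coprime)
    qed
    ultimately show ?case
      using insert assms(3)[of q] pideal_coprime_mult
      by (simp del: of_nat_power of_nat_prod of_nat_mult coprime_power_left_iff)
  qed
  from this[of "prime_factors n"] show ?thesis
    using prod_prime_factors[of n] assms(1) by simp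
qed

definition adjoin_cong :: "'a::comm_ring_1 \<Rightarrow> 'a \<Rightarrow> 'a \<Rightarrow> 'a \<Rightarrow> bool" where
  "adjoin_cong w d x y \<longleftrightarrow> x - y \<in> pideal w d"

abbreviation adjoin_cong_notation :: "'a::comm_ring_1 \<Rightarrow> 'a \<Rightarrow> 'a \<Rightarrow> 'a \<Rightarrow> bool"
    ("(1[_ = _] '(' mod _ over _'))") where
  "[x = y] (mod d over w) \<equiv> adjoin_cong w d x y"

lemma adjoin_cong_refl [simp]: "[x = x] (mod d over w)"
  by (simp add: adjoin_cong_def)

lemma adjoin_cong_sym: "[x = y] (mod d over w) \<Longrightarrow> [y = x] (mod d over w)"
  using pideal_diff[of 0 w d "x - y"] by (simp add: adjoin_cong_def)

lemma adjoin_cong_trans [trans]: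
  "[x = y] (mod d over w) \<Longrightarrow> [y = z] (mod d over w) \<Longrightarrow> [x = z] (mod d over w)"
  using pideal_add[of "x - y" w d "y - z"] by (simp add: adjoin_cong_def)

lemma adjoin_cong_0_iff: "[x = 0] (mod d over w) \<longleftrightarrow> x \<in> pideal w d"
  by (simp add: adjoin_cong_def)

lemma adjoin_cong_modulus:
  "[x = y] (mod d over w) \<Longrightarrow> d \<in> pideal w e \<Longrightarrow> [x = y] (mod e over w)"
  unfolding adjoin_cong_def by (rule pideal_trans)

lemma adjoin_cong_of_int:
  "[a = b] (mod c) \<Longrightarrow> [of_int a = of_int b] (mod of_int c over w)"
  using pideal_of_int[of c "a - b"] by (simp add: adjoin_cong_def cong_iff_dvd_diff)

lemma adjoin_cong_add:
  assumes "[x = y] (mod d over w)" "[x' = y'] (mod d over w)"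
  shows "[x + x' = y + y'] (mod d over w)"
  using pideal_add[OF assms[unfolded adjoin_cong_def]] by (simp add: adjoin_cong_def algebra_simps)

lemma adjoin_cong_sum:
  "(\<And>i. i \<in> A \<Longrightarrow> [f i = g i] (mod d over w)) \<Longrightarrow> [(\<Sum>i\<in>A. f i) = (\<Sum>i\<in>A. g i)] (mod d over w)"
  by (simp add: adjoin_cong_def pideal_sum flip: sum_subtractf)

lemma adjoin_cong_scalar_left:
  assumes "[x = y] (mod d over w)" "r \<in> int_adjoin w"
  shows "[r * x = r * y] (mod d over w)"
  using pideal_mult_left[OF assms(1)[unfolded adjoin_cong_def] assms(2)]
  by (simp add: adjoin_cong_def right_diff_distrib)

lemma adjoin_cong_mult:
  assumes "[x = y] (mod d over w)" "[x' = y'] (mod d over w)" "x' \<in> int_adjoin w" "y \<in> int_adjoin w"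
  shows "[x * x' = y * y'] (mod d over w)"
proof -
  have "[x' * x = x' * y] (mod d over w)" using assms by (intro adjoin_cong_scalar_left)
  also have "[x' * y = y * y'] (mod d over w)"
    unfolding mult.commute[of x' y] using assms by (intro adjoin_cong_scalar_left)
  finally show ?thesis by (simp add: mult.commute)
qed

lemma adjoin_cong_power:
  assumes "[x = y] (mod d over w)" "x \<in> int_adjoin w" "y \<in> int_adjoin w"
  shows "[x ^ k = y ^ k] (mod d over w)"
  by (induction k) (simp_all add: assms adjoin_cong_mult)

lemma adjoin_cong_ipoly:
  assumes "[u = v] (mod d over w)" "u \<in> int_adjoin w" "v \<in> int_adjoin w"
  shows "[ipoly P u = ipoly P v] (mod d over w)"
proof (induction P)
  case (pCons a P)
  then show ?case using assms by (simp add: adjoin_cong_add adjoin_cong_mult)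
qed simp

lemma adjoin_cong_idempotent_power:
  assumes "[x ^ 2 = x] (mod d over w)" "x \<in> int_adjoin w" "k > 0"
  shows "[x ^ k = x] (mod d over w)"
  using assms(3)
proof (induction k rule: nat_induct_non_zero)
  case (Suc k)
  have "[x * x ^ k = x * x] (mod d over w)"
    using Suc assms(2) by (intro adjoin_cong_scalar_left)
  also have "[x * x = x] (mod d over w)" using assms(1) by (simp add: power2_eq_square)
  finally show ?case by simp
qed simp

lemma adjoin_cong_lift_prime_power:
  assumes "of_nat q \<in> pideal w d" "x \<in> int_adjoin w" "y \<in> int_adjoin w"
    and "[x = y] (mod d over w)"
  shows "[x ^ (q ^ k) = y ^ (q ^ k)] (mod d ^ Suc k over w)"
proof (induction k)
  case (Suc k)
  define a b where "a = x ^ (q ^ k)" and "b = y ^ (q ^ k)"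
  have in_adjoin: "a \<in> int_adjoin w" "b \<in> int_adjoin w" using assms by (auto simp: a_def b_def)
  have "[a = b] (mod d over w)"
    unfolding a_def b_def using assms by (intro adjoin_cong_power)
  then have "[(\<Sum>i<q. b ^ (q - Suc i) * a ^ i) = (\<Sum>i<q. b ^ (q - Suc i) * b ^ i)] (mod d over w)"
    using in_adjoin by (intro adjoin_cong_sum adjoin_cong_scalar_left adjoin_cong_power) auto
  also have "(\<Sum>i<q. b ^ (q - Suc i) * b ^ i) = of_nat q * b ^ (q - 1)"
    by (simp flip: power_add)
  also have "[\<dots> = 0] (mod d over w)"
    unfolding adjoin_cong_0_iff using assms in_adjoin by (intro pideal_mult_right) auto
  finally have "(\<Sum>i<q. b ^ (q - Suc i) * a ^ i) \<in> pideal w d" by (simp only: adjoin_cong_0_iff)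
  moreover have "a - b \<in> pideal w (d ^ Suc k)"
    using Suc by (simp only: adjoin_cong_def a_def b_def)
  ultimately have "(a - b) * (\<Sum>i<q. b ^ (q - Suc i) * a ^ i) \<in> pideal w (d ^ Suc k * d)"
    by (intro pideal_mult)
  then have "[a ^ q = b ^ q] (mod d ^ Suc k * d over w)"
    unfolding adjoin_cong_def by (simp only: power_diff_sumr2)
  then show ?case by (simp add: a_def b_def power_mult[symmetric] mult_ac)
qed (use assms in simp)

lemma adjoin_cong_power_prime_add:
  assumes "prime q" "x \<in> int_adjoin w" "y \<in> int_adjoin w"
  shows "[(x + y) ^ q = x ^ q + y ^ q] (mod of_nat q over w)"
proof -
  have "q > 0" using assms(1) by (rule prime_gt_0_nat)
  let ?f = "\<lambda>k. of_nat (q choose k) * x ^ k * y ^ (q - k)"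
  have "{..q} = insert 0 (insert q {0<..<q})" using \<open>q > 0\<close> by auto
  then have "(\<Sum>k\<le>q. ?f k) = y ^ q + (x ^ q + (\<Sum>k\<in>{0<..<q}. ?f k))"
    using \<open>q > 0\<close> by simp
  then have "(x + y) ^ q - (x ^ q + y ^ q) = (\<Sum>k\<in>{0<..<q}. ?f k)"
    by (simp add: binomial_ring)
  moreover have "?f k \<in> pideal w (of_nat q)" if "k \<in> {0<..<q}" for k
  proof -
    have "q dvd (q choose k)" using that assms(1) by (intro dvd_choose_prime) auto
    then show ?thesis using assms by (intro pideal_mult_right pideal_of_nat) auto
  qed
  ultimately show ?thesis unfolding adjoin_cong_def by (simp only: pideal_sum)
qed

lemma cong_power_prime_int:
  assumes "prime (q :: nat)"
  shows "[a ^ q = a] (mod int q)"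
proof -
  define b where "b = nat (a mod int q)"
  have "q > 0" using assms by (rule prime_gt_0_nat)
  have "[b ^ q = b] (mod q)"
  proof (cases "q dvd b")
    case True
    then have "q dvd b ^ q" using \<open>q > 0\<close> by (meson dvd_power dvd_trans)
    then show ?thesis using True by (metis cong_0_iff cong_sym cong_trans)
  next
    case False
    then have "[b ^ (q - 1) * b = 1 * b] (mod q)"
      using assms by (intro cong_scalar_right fermat_theorem)
    then show ?thesis using \<open>q > 0\<close> by (simp flip: power_Suc2)
  qed
  then have "[int b ^ q = int b] (mod int q)" by (simp flip: of_nat_power add: cong_int_iff)
  moreover have "[int b = a] (mod int q)" using \<open>q > 0\<close> by (simp add: b_def cong_def)
  ultimately show ?thesis by (meson cong_pow cong_sym cong_trans)
qed

lemma frobenius_cong: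
  assumes "prime q" "v \<in> int_adjoin w"
  shows "[ipoly P v ^ q = ipoly P (v ^ q)] (mod of_nat q over w)"
proof (induction P)
  case 0
  then show ?case using assms by (simp add: prime_gt_0_nat power_0_left)
next
  case (pCons a P)
  have "[(of_int a + v * ipoly P v) ^ q = of_int a ^ q + (v * ipoly P v) ^ q] (mod of_nat q over w)"
    using assms by (intro adjoin_cong_power_prime_add) auto
  also have "[\<dots> = of_int a + v ^ q * ipoly P (v ^ q)] (mod of_nat q over w)"
    using adjoin_cong_of_int[OF cong_power_prime_int[OF assms(1), of a], of w] pCons.IH assms(2)
    unfolding power_mult_distrib by (intro adjoin_cong_add adjoin_cong_scalar_left) auto
  finally show ?case by simp
qed

lemma frobenius_power_cong:
  assumes "prime q"
  shows "[ipoly P w ^ (q ^ f) = ipoly P (w ^ (q ^ f))] (mod of_nat q over w)"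
proof (induction f)
  case (Suc f)
  have "[(ipoly P w ^ (q ^ f)) ^ q = ipoly P (w ^ (q ^ f)) ^ q] (mod of_nat q over w)"
    by (intro adjoin_cong_power Suc) auto
  also have "[ipoly P (w ^ (q ^ f)) ^ q = ipoly P ((w ^ (q ^ f)) ^ q)] (mod of_nat q over w)"
    by (rule frobenius_cong) (use assms in auto)
  finally show ?case unfolding power_mult[symmetric] power_Suc2 .
qed simp

lemma dvd_if_dvd_smult_of_content_1:
  fixes f P :: "'a::{factorial_semiring, semiring_Gcd, ring_gcd, idom_divide,
    semiring_gcd_mult_normalize} poly"
  assumes "f dvd smult a P" "content f = 1" "a \<noteq> 0"
  shows "f dvd P"
proof -
  have "fract_poly f dvd smult (to_fract a) (fract_poly P)"
    using fract_poly_dvd[OF assms(1)] by simp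
  then have "fract_poly f dvd fract_poly P"
    using assms(3) by (simp add: dvd_smult_cancel)
  then show ?thesis using assms(2) by (rule fract_poly_dvdD)
qed

lemma exists_primitive_min_poly:
  fixes x :: "'a::{idom, ring_char_0}"
  assumes "ipoly h x = 0" "h \<noteq> 0"
  obtains f where "content f = 1" "ipoly f x = 0" "\<And>P. ipoly P x = 0 \<Longrightarrow> f dvd P"
proof -
  define annihilates where "annihilates P \<longleftrightarrow> P \<noteq> 0 \<and> ipoly P x = 0" for P
  have "annihilates h" using assms by (simp add: annihilates_def)
  then obtain P0 where minimal: "annihilates P0" "\<And>P. annihilates P \<Longrightarrow> degree P0 \<le> degree P"
    using ex_has_least_nat[of annihilates _ degree] by blast
  define f where "f = primitive_part P0"
  have primitive_f: "f \<noteq> 0" "content f = 1" "degree f = degree P0"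
    using minimal(1) by (auto simp: f_def annihilates_def)
  have "of_int (content P0) * ipoly f x = 0"
    using minimal(1) by (simp add: f_def annihilates_def flip: ipoly_smult)
  then have root: "ipoly f x = 0" using minimal(1) by (simp add: annihilates_def)
  have "f dvd P" if "ipoly P x = 0" for P
  proof -
    obtain a Q where division: "a \<noteq> 0" "smult a P = f * Q + pseudo_mod P f"
      using pseudo_mod(1)[OF primitive_f(1), of P] by blast
    have "ipoly (smult a P) x = ipoly (f * Q + pseudo_mod P f) x" by (simp only: division(2))
    then have "ipoly (pseudo_mod P f) x = 0" using that root by simp
    then have "pseudo_mod P f = 0"
      using pseudo_mod(2)[OF primitive_f(1), of P] minimal(2)[of "pseudo_mod P f"] primitive_f(3)
      unfolding annihilates_def by linarith
    then show ?thesis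
      using division primitive_f(2) by (intro dvd_if_dvd_smult_of_content_1[of f a P]) auto
  qed
  with primitive_f(2) root show ?thesis by (rule that)
qed

lemma algebraic_int_min_poly:
  fixes x :: "'a::field_char_0"
  assumes "algebraic_int x"
  obtains f where "lead_coeff f = 1" "ipoly f x = 0" "\<And>P. ipoly P x = 0 \<Longrightarrow> f dvd P"
proof -
  obtain h where monic: "ipoly h x = 0" "lead_coeff h = 1"
    using assms unfolding algebraic_int_altdef_ipoly ipoly_def by blast
  then have "h \<noteq> 0" by auto
  then obtain f where min_poly: "ipoly f x = 0" "\<And>P. ipoly P x = 0 \<Longrightarrow> f dvd P"
    using exists_primitive_min_poly[OF monic(1)] by blast
  obtain g where "h = f * g" using min_poly(2)[OF monic(1)] by (elim dvdE)
  then have "lead_coeff f * lead_coeff g = 1" using monic(2) by (simp add: lead_coeff_mult)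
  then consider "lead_coeff f = 1" | "lead_coeff (- f) = 1" by (auto simp: zmult_eq_1_iff)
  then show ?thesis using that[of f] that[of "- f"] min_poly by cases simp_all
qed

lemma of_int_in_pideal_iff:
  fixes x :: "'a::field_char_0"
  assumes "algebraic_int x"
  shows "of_int b \<in> pideal x (of_int a) \<longleftrightarrow> a dvd b"
proof
  assume "of_int b \<in> pideal x (of_int a)"
  then obtain Q where multiple: "of_int b = of_int a * ipoly Q x"
    by (elim pidealE int_adjoinE) blast
  obtain f where min_poly: "lead_coeff f = 1" "ipoly f x = 0" "\<And>P. ipoly P x = 0 \<Longrightarrow> f dvd P"
    using algebraic_int_min_poly[OF assms] by blast
  obtain A R where "pseudo_divmod Q f = (A, R)" by force
  then have division: "Q = f * A + R" "R = 0 \<or> degree R < degree f"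
    using pseudo_divmod[of f Q A R] min_poly(1) by (force, force)
  have "degree f > 0"
  proof (rule ccontr)
    assume "\<not> degree f > 0"
    then obtain c where "f = [:c:]" by (metis degree_eq_zeroE gr0I)
    then show False using min_poly(1,2) by simp
  qed
  then have "degree (smult a R - [:b:]) < degree f"
    using division(2) by (intro degree_diff_less) auto
  moreover have "ipoly (smult a R - [:b:]) x = 0"
    using multiple min_poly(2) by (simp add: division(1))
  then have "f dvd smult a R - [:b:]" by (rule min_poly(3))
  ultimately have "smult a R - [:b:] = 0" using dvd_imp_degree_le leD by blast
  then have "coeff (smult a R - [:b:]) 0 = 0" by simp
  then have "b = a * coeff R 0" by simp
  then show "a dvd b" by (rule dvdI)
qed (rule pideal_of_int)

section \<open>Primitive roots of unity\<close>

definition prim_root :: "nat \<Rightarrow> 'a::idom \<Rightarrow> bool" where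
  "prim_root M w \<longleftrightarrow> M > 0 \<and> (\<forall>j. w ^ j = 1 \<longleftrightarrow> M dvd j)"

lemma prim_rootD:
  assumes "prim_root M w"
  shows "M > 0" "w ^ M = 1" "w ^ j = 1 \<longleftrightarrow> M dvd j" "w \<noteq> 0"
proof -
  show "M > 0" and "w ^ M = 1" and "w ^ j = 1 \<longleftrightarrow> M dvd j"
    using assms by (auto simp: prim_root_def)
  then show "w \<noteq> 0" by (auto simp: power_0_left)
qed

lemma prim_root_power_eq_1: "prim_root M w \<Longrightarrow> (w ^ a) ^ M = 1"
  using prim_rootD(2)[of M w] by (metis mult.commute power_mult power_one)

lemma prim_root_power:
  assumes "prim_root M w"
  shows "prim_root (M div gcd M k) (w ^ k)"
proof -
  have "M > 0" using assms by (rule prim_rootD)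
  define g where "g = gcd M k"
  have "g > 0" using \<open>M > 0\<close> by (simp add: g_def)
  then obtain M' k' where decomp: "M = M' * g" "k = k' * g" and "coprime M' k'"
    using gcd_coprime_exists[of M k, folded g_def] by blast
  have "M dvd k * j \<longleftrightarrow> M' dvd j" for j
  proof -
    have "M dvd k * j \<longleftrightarrow> M' * g dvd k' * j * g" by (simp only: decomp ac_simps)
    also have "\<dots> \<longleftrightarrow> M' dvd j"
      using \<open>g > 0\<close> \<open>coprime M' k'\<close> by (simp add: coprime_dvd_mult_right_iff)
    finally show ?thesis .
  qed
  moreover have "M div g = M'" using \<open>g > 0\<close> by (simp add: decomp)
  moreover have "M' > 0" using \<open>M > 0\<close> by (simp add: decomp)
  ultimately show ?thesis
    using prim_rootD(3)[OF assms]
    unfolding g_def[symmetric] prim_root_def power_mult[symmetric] by simp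
qed

lemma prim_root_power_coprime: "prim_root M w \<Longrightarrow> coprime t M \<Longrightarrow> prim_root M (w ^ t)"
  using prim_root_power[of M w t] by (simp add: coprime_commute)

lemma prim_root_power_dvd: "prim_root (M * k) w \<Longrightarrow> prim_root M (w ^ k)"
  using prim_root_power[of "M * k" w k] by (cases "k = 0") (simp_all add: prim_root_def)

lemma prim_root_power_mod:
  assumes "prim_root M w"
  shows "w ^ (j mod M) = w ^ j"
proof -
  have "w ^ j = w ^ (M * (j div M) + j mod M)" by simp
  also have "\<dots> = w ^ (j mod M)"
    using prim_rootD(2)[OF assms] by (simp only: power_add power_mult) simp
  finally show ?thesis by simp
qed

lemma prim_root_power_eq_iff:
  assumes "prim_root M w"
  shows "w ^ i = w ^ j \<longleftrightarrow> [i = j] (mod M)"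
proof (induction i j rule: linorder_wlog)
  case (le i j)
  have "w ^ j = w ^ i * w ^ (j - i)" using le by (simp flip: power_add)
  then have "w ^ i = w ^ j \<longleftrightarrow> w ^ (j - i) = 1" using prim_rootD(4)[OF assms] by auto
  also have "\<dots> \<longleftrightarrow> M dvd j - i" using prim_rootD(3)[OF assms] .
  also have "\<dots> \<longleftrightarrow> [j = i] (mod M)" using le by (simp add: cong_altdef_nat)
  finally show ?case by (simp add: cong_sym_eq)
qed (metis cong_sym)

lemma prim_root_half:
  assumes "prim_root (2 * k) w"
  shows "w ^ k = -1"
proof -
  have "(w ^ k)\<^sup>2 = 1" using prim_rootD(2)[OF assms] by (simp add: mult.commute flip: power_mult)
  moreover have "w ^ k \<noteq> 1"
    using prim_rootD(1,3)[OF assms] by (auto dest: dvd_imp_le)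
  ultimately show ?thesis by (simp add: power2_eq_1_iff)
qed

lemma prim_root_uminus:
  fixes w :: "'a::{idom, ring_char_0}"
  assumes "prim_root M w" "odd M"
  shows "prim_root (2 * M) (- w)"
  unfolding prim_root_def
proof (intro conjI allI)
  note root_props = prim_rootD[OF assms(1)]
  fix j
  show "(- w) ^ j = 1 \<longleftrightarrow> 2 * M dvd j"
  proof (cases "even j")
    case True
    then have "2 * M dvd j \<longleftrightarrow> M dvd j" using assms(2)
      by (metis coprime_commute coprime_left_2_iff_odd divides_mult dvd_mult_right)
    then show ?thesis using True root_props(3) by simp
  next
    case False
    have "(- w) ^ j \<noteq> 1"
    proof
      assume "(- w) ^ j = 1"
      then have "w ^ j = -1" using False by (simp add: equation_minus_iff)
      then have "(w ^ j) ^ M = -1" using assms(2) by simp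
      then show False by (simp add: prim_root_power_eq_1[OF assms(1)])
    qed
    moreover have "\<not> 2 * M dvd j" using False by (meson dvd_mult_left)
    ultimately show ?thesis by simp
  qed
qed (use prim_rootD(1)[OF assms(1)] in simp)

lemma prim_root_sum_powers:
  assumes "prim_root M w"
  shows "(\<Sum>a<M. w ^ (a * k)) = (if M dvd k then of_nat M else 0)"
proof (cases "M dvd k")
  case True
  then have "w ^ (a * k) = 1" for a using prim_rootD(3)[OF assms] by simp
  then show ?thesis using True by simp
next
  case False
  have "(w ^ k - 1) * (\<Sum>a<M. (w ^ k) ^ a) = 0"
    by (simp add: prim_root_power_eq_1[OF assms] flip: power_diff_1_eq)
  then have "(\<Sum>a<M. (w ^ k) ^ a) = 0" using False prim_rootD(3)[OF assms] by simp
  then show ?thesis using False by (simp add: mult.commute flip: power_mult)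
qed

text \<open>The exponent \<open>M - y\<close> stands for \<open>- y\<close>.\<close>

lemma prim_root_fourier_inversion:
  assumes "prim_root M w" "y < M" "finite V"
  shows "(\<Sum>a<M. w ^ (a * (M - y)) * (\<Sum>v\<in>V. f v * w ^ (a * v)))
    = of_nat M * (\<Sum>v | v \<in> V \<and> v mod M = y. f v)"
proof -
  have "(\<Sum>a<M. w ^ (a * (M - y)) * (\<Sum>v\<in>V. f v * w ^ (a * v)))
      = (\<Sum>v\<in>V. f v * (\<Sum>a<M. w ^ (a * (v + (M - y)))))"
    unfolding sum_distrib_left by (subst sum.swap) (simp add: algebra_simps power_add)
  also have "\<dots> = (\<Sum>v\<in>V. if v mod M = y then of_nat M * f v else 0)"
  proof (intro sum.cong refl)
    fix v
    have "M dvd v + (M - y) \<longleftrightarrow> [v + (M - y) + y = 0 + y] (mod M)"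
      by (simp only: cong_add_rcancel_nat cong_0_iff)
    also have "\<dots> \<longleftrightarrow> v mod M = y" using assms(2) by (simp add: cong_def)
    finally show "f v * (\<Sum>a<M. w ^ (a * (v + (M - y))))
        = (if v mod M = y then of_nat M * f v else 0)"
      by (simp add: prim_root_sum_powers[OF assms(1)])
  qed
  also have "\<dots> = of_nat M * (\<Sum>v | v \<in> V \<and> v mod M = y. f v)"
    using assms(3) by (simp add: sum.If_cases sum_distrib_left Int_def)
  finally show ?thesis .
qed

lemma prod_linear_prim_root:
  fixes x :: "'a::idom"
  assumes "prim_root N x"
  shows "(\<Prod>j<N. [:- (x ^ j), 1:]) = monom 1 N - 1"
proof -
  note root_props = prim_rootD[OF assms]
  have deg: "degree (monom 1 N - 1 :: 'a poly) = N"
    using root_props(1)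
    by (subst diff_conv_add_uminus, subst degree_add_eq_left) (auto simp: degree_monom_eq)
  have deg_prod: "degree (\<Prod>j<N. [:- (x ^ j), 1:]) = N"
    by (subst degree_prod_eq_sum_degree) auto
  show ?thesis
  proof (rule poly_eqI_degree_lead_coeff[where n = N and A = "(\<lambda>j. x ^ j) ` {..<N}"])
    have "lead_coeff (\<Prod>j<N. [:- (x ^ j), 1:]) = 1"
      by (simp add: lead_coeff_prod)
    then show "coeff (\<Prod>j<N. [:- (x ^ j), 1:]) N = coeff (monom 1 N - 1) N"
      using root_props(1) by (simp add: deg_prod)
    have "inj_on (\<lambda>j. x ^ j) {..<N}"
      using prim_root_power_eq_iff[OF assms] by (auto simp: inj_on_def cong_def)
    then show "card ((\<lambda>j. x ^ j) ` {..<N}) \<ge> N" by (simp add: card_image)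
    fix z assume "z \<in> (\<lambda>j. x ^ j) ` {..<N}"
    then obtain j where z_eq: "z = x ^ j" "j < N" by auto
    have "poly (monom 1 N - 1) z = 0"
      by (simp add: z_eq poly_monom prim_root_power_eq_1[OF assms])
    moreover have "poly (\<Prod>j<N. [:- (x ^ j), 1:]) z = 0"
      using z_eq by (auto simp: poly_prod)
    ultimately show "poly (\<Prod>j<N. [:- (x ^ j), 1:]) z = poly (monom 1 N - 1) z" by simp
  qed (simp_all add: deg deg_prod)
qed

lemma root_of_unity_eq_power:
  assumes "prim_root M w" "y ^ M = 1"
  obtains s where "y = w ^ s" "s < M"
proof -
  have "poly (\<Prod>j<M. [:- (w ^ j), 1:]) y = 0"
    unfolding prod_linear_prim_root[OF assms(1)] using assms(2) by (simp add: poly_monom)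
  then have "\<exists>j<M. y = w ^ j" by (auto simp: poly_prod prod_zero_iff)
  then show ?thesis using that by blast
qed

lemma algebraic_int_prim_root:
  fixes w :: "'a::field_char_0"
  assumes "prim_root M w"
  shows "algebraic_int w"
proof (rule algebraic_int_root[of 1 "monom 1 M"])
  show "poly (monom 1 M) w = 1" using prim_rootD(2)[OF assms] by (simp add: poly_monom)
qed (use prim_rootD(1)[OF assms] in \<open>auto simp: degree_monom_eq\<close>)

definition zeta :: "nat \<Rightarrow> complex" where
  "zeta M = cis (2 * pi / real M)"

lemma prim_root_zeta:
  assumes "M > 0"
  shows "prim_root M (zeta M)"
  unfolding prim_root_def
proof (intro conjI allI)
  fix j
  have "zeta M ^ j = cis (j * (2 * pi / M))" by (simp add: zeta_def DeMoivre)
  also have "\<dots> = 1 \<longleftrightarrow> cos (j * (2 * pi / M)) = 1"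
    by (auto simp: complex_eq_iff cos_one_sin_zero)
  also have "\<dots> \<longleftrightarrow> (\<exists>k::int. j * (2 * pi / M) = k * 2 * pi)"
    by (simp add: cos_one_2pi_int)
  also have "\<dots> \<longleftrightarrow> (\<exists>k::int. real_of_int (int j) = real_of_int (int M * k))"
    using assms by (intro ex_cong1) (auto simp: field_simps)
  also have "\<dots> \<longleftrightarrow> M dvd j" by (simp only: of_int_eq_iff flip: dvd_def int_dvd_int_iff)
  finally show "zeta M ^ j = 1 \<longleftrightarrow> M dvd j" .
qed (rule assms)

lemma norm_zeta [simp]: "norm (zeta M) = 1"
  by (simp add: zeta_def)

lemma zeta_mult_power: "k > 0 \<Longrightarrow> zeta (M * k) ^ k = zeta M"
  by (cases "M = 0") (simp_all add: zeta_def DeMoivre)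

section \<open>Automorphisms of cyclotomic rings\<close>

lemma ipoly_factor_pderiv_at_root_of_unity:
  fixes v :: "'a::idom"
  assumes "f * g = monom 1 M - 1" "M > 0" "v ^ M = 1" "ipoly g v = 0"
  shows "ipoly f v * (ipoly (pderiv g) v * v) = of_nat M"
proof -
  have "ipoly (pderiv (f * g)) v = of_nat M * v ^ (M - 1)"
    by (simp add: assms(1) pderiv_diff pderiv_monom)
  then have "ipoly f v * ipoly (pderiv g) v = of_nat M * v ^ (M - 1)"
    by (simp add: pderiv_mult assms(4))
  then have "ipoly f v * (ipoly (pderiv g) v * v) = of_nat M * (v ^ (M - 1) * v)"
    by (simp flip: mult.assoc)
  also have "v ^ (M - 1) * v = 1" using assms(2,3) by (simp flip: power_Suc2)
  finally show ?thesis by simp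
qed

lemma ipoly_conjugate_prime:
  fixes w :: "'a::field_char_0"
  assumes "prim_root M w" "prime l" "\<not> l dvd M" "ipoly P w = 0"
  shows "ipoly P (w ^ l) = 0"
proof -
  have "M > 0" "w ^ M = 1" using prim_rootD[OF assms(1)] by blast+
  note integral = algebraic_int_prim_root[OF assms(1)]
  obtain f where min_poly: "ipoly f w = 0" "\<And>P. ipoly P w = 0 \<Longrightarrow> f dvd P"
    using algebraic_int_min_poly[OF integral] by blast
  have "f dvd monom 1 M - 1" using \<open>w ^ M = 1\<close> by (intro min_poly(2)) simp
  then obtain g where factors: "f * g = monom 1 M - 1" by (metis dvdE)
  define v where "v = w ^ l"
  have "v ^ M = 1" by (simp add: v_def prim_root_power_eq_1[OF assms(1)])
  have "ipoly f v = 0"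
  proof (rule ccontr)
    assume "ipoly f v \<noteq> 0"
    moreover have "ipoly (f * g) v = 0" by (simp only: factors) (simp add: \<open>v ^ M = 1\<close>)
    ultimately have "ipoly g v = 0" by simp
    have "[ipoly f v = ipoly f w ^ l] (mod of_nat l over w)"
      unfolding v_def using assms(2) by (intro adjoin_cong_sym[OF frobenius_cong]) auto
    then have "ipoly f v \<in> pideal w (of_nat l)"
      using min_poly(1) prime_gt_0_nat[OF assms(2)] by (simp add: power_0_left adjoin_cong_0_iff)
    then have "ipoly f v * (ipoly (pderiv g) v * v) \<in> pideal w (of_nat l)"
      by (intro pideal_mult_right) (auto simp: v_def)
    then have "of_nat M \<in> pideal w (of_nat l)"
      by (simp only: ipoly_factor_pderiv_at_root_of_unity[OF factors \<open>M > 0\<close> \<open>v ^ M = 1\<close> \<open>ipoly g v = 0\<close>])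
    then have "int l dvd int M"
      using of_int_in_pideal_iff[OF integral, of "int M" "int l"] by simp
    then show False using assms(3) by simp
  qed
  moreover obtain Q where "P = f * Q" using min_poly(2)[OF assms(4)] by (elim dvdE)
  ultimately show ?thesis by (simp add: v_def)
qed

text \<open>This is the irreducibility of the cyclotomic polynomials.\<close>

lemma ipoly_conjugate:
  fixes w :: "'a::field_char_0"
  assumes "prim_root M w" "coprime t M" "ipoly P w = 0"
  shows "ipoly P (w ^ t) = 0"
  using assms
proof (induction t arbitrary: w rule: prime_divisors_induct)
  case zero
  then have "w ^ 1 = 1" using prim_rootD(3)[of M w 1] by simp
  then show ?case using zero by simp
next
  case (unit t)
  then show ?case by simp
next
  case (factor l t)
  have "\<not> l dvd M" using factor by (metis coprime_common_divisor dvd_triv_left not_prime_unit)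
  then have "ipoly P (w ^ l) = 0" using factor by (intro ipoly_conjugate_prime[of M]) auto
  moreover have "prim_root M (w ^ l)" using factor by (intro prim_root_power_coprime) auto
  ultimately show ?case using factor by (simp add: power_mult)
qed

text \<open>The value depends on the choice of the polynomial, unless \<open>w\<close> is a primitive root of unity of an
  order prime to \<open>t\<close>.\<close>

definition galois :: "'a::comm_ring_1 \<Rightarrow> nat \<Rightarrow> 'a \<Rightarrow> 'a" where
  "galois w t x = ipoly (SOME P. x = ipoly P w) (w ^ t)"

locale cyclotomic_automorphism =
  fixes M :: nat and w :: "'a::field_char_0" and t :: nat
  assumes prim_root: "prim_root M w" and coprime_exponent: "coprime t M"
begin

lemma galois_ipoly: "galois w t (ipoly P w) = ipoly P (w ^ t)"
proof -
  define Q where "Q = (SOME Q. ipoly P w = ipoly Q w)"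
  have "ipoly P w = ipoly Q w" unfolding Q_def by (rule someI[of _ P]) simp
  then have "ipoly (P - Q) w = 0" by simp
  then have "ipoly (P - Q) (w ^ t) = 0" by (rule ipoly_conjugate[OF prim_root coprime_exponent])
  then show ?thesis by (simp add: galois_def Q_def)
qed

lemma galois_in_int_adjoin [intro, simp]: "x \<in> int_adjoin w \<Longrightarrow> galois w t x \<in> int_adjoin w"
  by (auto elim!: int_adjoinE simp: galois_ipoly)

lemma galois_generator: "galois w t w = w ^ t"
  using galois_ipoly[of "[:0, 1:]"] by simp

lemma galois_0 [simp]: "galois w t 0 = 0"
  using galois_ipoly[of 0] by simp

lemma galois_1 [simp]: "galois w t 1 = 1"
  using galois_ipoly[of 1] by simp

lemma galois_of_int [simp]: "galois w t (of_int a) = of_int a"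
  using galois_ipoly[of "[:a:]"] by simp

lemma galois_of_nat [simp]: "galois w t (of_nat a) = of_nat a"
  using galois_of_int[of "int a"] by simp

lemma galois_add [simp]:
  "x \<in> int_adjoin w \<Longrightarrow> y \<in> int_adjoin w \<Longrightarrow> galois w t (x + y) = galois w t x + galois w t y"
  by (auto elim!: int_adjoinE simp: galois_ipoly simp flip: ipoly_add)

lemma galois_diff [simp]:
  "x \<in> int_adjoin w \<Longrightarrow> y \<in> int_adjoin w \<Longrightarrow> galois w t (x - y) = galois w t x - galois w t y"
  by (auto elim!: int_adjoinE simp: galois_ipoly simp flip: ipoly_diff)

lemma galois_mult [simp]:
  "x \<in> int_adjoin w \<Longrightarrow> y \<in> int_adjoin w \<Longrightarrow> galois w t (x * y) = galois w t x * galois w t y"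
  by (auto elim!: int_adjoinE simp: galois_ipoly simp flip: ipoly_mult)

lemma galois_power [simp]: "x \<in> int_adjoin w \<Longrightarrow> galois w t (x ^ k) = galois w t x ^ k"
  by (induction k) simp_all

lemma galois_ipoly_compose: "x \<in> int_adjoin w \<Longrightarrow> galois w t (ipoly P x) = ipoly P (galois w t x)"
  by (induction P) simp_all

lemma galois_sum:
  "(\<And>i. i \<in> A \<Longrightarrow> f i \<in> int_adjoin w) \<Longrightarrow> galois w t (\<Sum>i\<in>A. f i) = (\<Sum>i\<in>A. galois w t (f i))"
  by (induction A rule: infinite_finite_induct) simp_all

lemma galois_root_of_unity:
  assumes "x ^ M = 1"
  shows "galois w t x = x ^ t"
proof -
  obtain s where "x = w ^ s" using root_of_unity_eq_power[OF prim_root assms] by blast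
  then show ?thesis by (simp add: galois_generator mult.commute flip: power_mult)
qed

lemma root_of_unity_in_int_adjoin: "x ^ M = 1 \<Longrightarrow> x \<in> int_adjoin w"
  using root_of_unity_eq_power[OF prim_root] by auto

end

lemma norm_root_of_unity: "norm x = 1" if "x ^ h = 1" "h > 0" for x :: complex
  using power_eq_1_iff[OF that(1)] that(2) by simp

lemma norm_power2_eq_of_nat_iff: "(norm z)\<^sup>2 = of_nat n \<longleftrightarrow> z * cnj z = of_nat n"
  unfolding complex_norm_square[symmetric] by (metis of_real_eq_iff of_real_of_nat_eq)

lemma cnj_root_of_unity:
  assumes "x ^ M = 1" "M > 0"
  shows "cnj x = x ^ (M - 1)"
proof -
  have "x * cnj x = 1"
    using norm_root_of_unity[OF assms] by (simp flip: complex_norm_square)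
  moreover have "x * x ^ (M - 1) = 1" using assms by (simp flip: power_Suc)
  ultimately show ?thesis by (metis mult_cancel_left zero_neq_one mult_zero_left)
qed

lemma cnj_ipoly: "cnj (ipoly P z) = ipoly P (cnj z)"
  by (simp add: ipoly_altdef)

lemma cnj_in_int_adjoin:
  assumes "prim_root M w" "x \<in> int_adjoin w"
  shows "cnj x \<in> int_adjoin w"
  using assms(2)
  by (auto elim!: int_adjoinE
      simp: cnj_ipoly cnj_root_of_unity[OF prim_rootD(2,1)[OF assms(1)]])

lemma galois_cnj:
  fixes w :: complex
  assumes "prim_root M w" "coprime t M" "x \<in> int_adjoin w"
  shows "galois w t (cnj x) = cnj (galois w t x)"
proof -
  interpret cyclotomic_automorphism M w t using assms by unfold_locales
  obtain P where x_eq: "x = ipoly P w" using assms(3) by (elim int_adjoinE)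
  have cnj: "cnj (w ^ a) = (w ^ a) ^ (M - 1)" for a
    using prim_rootD(1)[OF assms(1)] by (intro cnj_root_of_unity prim_root_power_eq_1[OF assms(1)])
  have "galois w t (cnj x) = galois w t (ipoly P (w ^ (M - 1)))"
    using cnj[of 1] by (simp add: x_eq cnj_ipoly)
  also have "\<dots> = ipoly P (cnj (w ^ t))"
    by (simp only: galois_ipoly_compose galois_power galois_generator cnj int_adjoin_self int_adjoin_power)
  also have "\<dots> = cnj (galois w t x)" by (simp only: x_eq galois_ipoly cnj_ipoly)
  finally show ?thesis .
qed

lemma norm_power2_galois:
  fixes w :: complex
  assumes "prim_root M w" "coprime t M" "x \<in> int_adjoin w" "(norm x)\<^sup>2 = of_nat n"
  shows "(norm (galois w t x))\<^sup>2 = of_nat n"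
proof -
  interpret cyclotomic_automorphism M w t using assms by unfold_locales
  have "galois w t (x * cnj x) = of_nat n"
    using assms(4) by (simp add: norm_power2_eq_of_nat_iff)
  then show ?thesis
    using assms(3) cnj_in_int_adjoin[OF assms(1,3)] galois_cnj[OF assms(1-3)]
    by (simp add: norm_power2_eq_of_nat_iff)
qed

section \<open>Roots of unity in cyclotomic rings\<close>

lemma ipoly_bounded_coefficients:
  fixes w :: complex
  assumes "prim_root M w" "norm w = 1" "(\<Sum>a<M. norm (ipoly Q (w ^ a))) \<le> B"
  obtains c :: "nat \<Rightarrow> int"
  where "ipoly Q w = (\<Sum>i<M. of_int (c i) * w ^ i)" "\<And>i. i < M \<Longrightarrow> \<bar>of_int (c i)\<bar> \<le> B"
proof -
  have "M > 0" using assms(1) by (rule prim_rootD)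
  define c where "c i = (\<Sum>k | k \<in> {..degree Q} \<and> k mod M = i. coeff Q k)" for i
  have "ipoly Q w = (\<Sum>k\<in>{..degree Q}. of_int (coeff Q k) * w ^ (k mod M))"
    by (simp add: ipoly_altdef prim_root_power_mod[OF assms(1)])
  also have "\<dots> = (\<Sum>i\<in>{..<M}. \<Sum>k\<in>{k \<in> {..degree Q}. k mod M = i}. of_int (coeff Q k) * w ^ (k mod M))"
    using \<open>M > 0\<close> by (intro sum.group[symmetric]) auto
  also have "\<dots> = (\<Sum>i<M. of_int (c i) * w ^ i)"
    by (simp add: c_def sum_distrib_right)
  finally have "ipoly Q w = (\<Sum>i<M. of_int (c i) * w ^ i)" .
  moreover have "\<bar>of_int (c i)\<bar> \<le> B" if "i < M" for i
  proof -
    have "of_nat M * of_int (c i) = (\<Sum>a<M. w ^ (a * (M - i)) * ipoly Q (w ^ a))"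
      unfolding ipoly_altdef[of Q "w ^ _"] c_def of_int_sum power_mult[symmetric]
      by (intro prim_root_fourier_inversion[OF assms(1) that, symmetric]) simp
    then have "norm (of_nat M * of_int (c i) :: complex) \<le> (\<Sum>a<M. norm (ipoly Q (w ^ a)))"
      using norm_sum[of "\<lambda>a. w ^ (a * (M - i)) * ipoly Q (w ^ a)" "{..<M}"]
      by (simp add: norm_mult norm_power assms(2))
    also have "\<dots> \<le> B" by (rule assms(3))
    finally have "real M * \<bar>of_int (c i)\<bar> \<le> B" by (simp add: norm_mult)
    moreover have "1 * \<bar>of_int (c i)\<bar> \<le> real M * \<bar>of_int (c i) :: real\<bar>"
      using \<open>M > 0\<close> by (intro mult_right_mono) auto
    ultimately show ?thesis by simp
  qed
  ultimately show ?thesis using that by blast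
qed

lemma coprime_nat_iff_no_common_prime:
  fixes a b :: nat
  shows "coprime a b \<longleftrightarrow> (\<forall>p. prime p \<longrightarrow> p dvd a \<longrightarrow> \<not> p dvd b)"
proof
  assume "coprime a b"
  then show "\<forall>p. prime p \<longrightarrow> p dvd a \<longrightarrow> \<not> p dvd b"
    using coprime_common_divisor not_prime_unit by blast
next
  assume no_common: "\<forall>p. prime p \<longrightarrow> p dvd a \<longrightarrow> \<not> p dvd b"
  show "coprime a b"
  proof (rule ccontr)
    assume "\<not> coprime a b"
    then have "gcd a b \<noteq> 1" using coprime_iff_gcd_eq_1 by blast
    then obtain p where "prime p" "p dvd gcd a b" using prime_factor_nat by blast
    then have "prime p" "p dvd a" "p dvd b" by simp_all
    then show False using no_common by blast
  qed
qed

lemma nonprimitive_powers_cofactor: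
  fixes w :: "'a::idom"
  assumes "prim_root M w"
  obtains g where "ipoly g w \<noteq> 0" "\<And>a. \<not> coprime a M \<Longrightarrow> ipoly g (w ^ a) = 0"
proof -
  note root_props = prim_rootD[OF assms]
  define g :: "int poly" where "g = (\<Prod>l\<in>prime_factors M. monom 1 (M div l) - 1)"
  have "w ^ (M div l) \<noteq> 1" if "l \<in> prime_factors M" for l
  proof -
    have "prime l" "l dvd M" using that by (auto simp: prime_factors_dvd)
    then have "M div l < M" "0 < M div l"
      using root_props(1) prime_gt_1_nat[of l] by (simp_all add: dvd_imp_le div_greater_zero_iff)
    then show ?thesis using dvd_imp_le[of M "M div l"] root_props(3)[of "M div l"] by auto
  qed
  then have "ipoly g w \<noteq> 0" by (simp add: g_def)
  moreover have "ipoly g (w ^ a) = 0" if not_coprime: "\<not> coprime a M" for a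
  proof -
    obtain l where common_prime: "prime l" "l dvd a" "l dvd M"
      using not_coprime unfolding coprime_nat_iff_no_common_prime by blast
    obtain b where "a = l * b" using common_prime(2) by (elim dvdE)
    then have "a * (M div l) = l * (M div l) * b" by (simp only: ac_simps)
    also have "l * (M div l) = M" using common_prime(3) by simp
    finally have "(w ^ a) ^ (M div l) = 1" by (simp add: root_props(3) flip: power_mult)
    moreover have "l \<in> prime_factors M"
      using common_prime root_props(1) by (simp add: prime_factors_dvd)
    ultimately show ?thesis by (auto simp: g_def intro: prod_zero)
  qed
  ultimately show ?thesis by (rule that)
qed

text \<open>The cofactor \<open>g\<close> of \<open>nonprimitive_powers_cofactor\<close> vanishes at the powers of \<open>w\<close> that are not
  conjugate to \<open>w\<close>, so bounds on the conjugates of \<open>x\<close> bound the Fourier transform of \<open>x g(w)\<close>, hence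
  its coefficients.\<close>

lemma finite_int_adjoin_bounded_conjugates:
  fixes w :: complex
  assumes "prim_root M w"
  shows "finite {x \<in> int_adjoin w. \<forall>t. coprime t M \<longrightarrow> norm (galois w t x) \<le> B}"
    (is "finite ?X")
proof -
  have "norm w = 1" using norm_root_of_unity prim_rootD(1,2)[OF assms] by blast
  obtain g where cofactor: "ipoly g w \<noteq> 0" "\<And>a. \<not> coprime a M \<Longrightarrow> ipoly g (w ^ a) = 0"
    using nonprimitive_powers_cofactor[OF assms] by blast
  define C where "C = (\<Sum>a<M. B * norm (ipoly g (w ^ a)))"
  define F where "F = PiE {..<M} (\<lambda>_. {-\<lfloor>C\<rfloor>..\<lfloor>C\<rfloor>})"
  have "?X \<subseteq> (\<lambda>c. (\<Sum>i<M. of_int (c i) * w ^ i) / ipoly g w) ` F"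
  proof
    fix x assume "x \<in> ?X"
    then obtain P where x_eq: "x = ipoly P w" and bound: "\<And>t. coprime t M \<Longrightarrow> norm (galois w t x) \<le> B"
      by (auto elim!: int_adjoinE)
    have "norm (ipoly (P * g) (w ^ a)) \<le> B * norm (ipoly g (w ^ a))" for a
    proof (cases "coprime a M")
      case True
      then interpret cyclotomic_automorphism M w a using assms by unfold_locales
      show ?thesis using bound[OF True] by (simp add: x_eq galois_ipoly norm_mult mult_right_mono)
    qed (simp add: cofactor(2))
    then have "(\<Sum>a<M. norm (ipoly (P * g) (w ^ a))) \<le> C" unfolding C_def by (rule sum_mono)
    then obtain c where coefficients: "ipoly (P * g) w = (\<Sum>i<M. of_int (c i) * w ^ i)"
        "\<And>i. i < M \<Longrightarrow> \<bar>of_int (c i)\<bar> \<le> C"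
      using ipoly_bounded_coefficients[OF assms \<open>norm w = 1\<close>] by metis
    have "\<bar>c i\<bar> \<le> \<lfloor>C\<rfloor>" if "i < M" for i using coefficients(2)[OF that] by (simp add: le_floor_iff)
    then have "restrict c {..<M} \<in> F" by (simp add: F_def PiE_iff abs_le_iff minus_le_iff)
    moreover have "x = (\<Sum>i<M. of_int (restrict c {..<M} i) * w ^ i) / ipoly g w"
      using coefficients(1) cofactor(1) by (simp add: x_eq field_simps)
    ultimately show "x \<in> (\<lambda>c. (\<Sum>i<M. of_int (c i) * w ^ i) / ipoly g w) ` F" by blast
  qed
  moreover have "finite F" unfolding F_def by (intro finite_PiE) auto
  ultimately show ?thesis by (meson finite_imageI finite_subset)
qed

lemma int_adjoin_norm_1_imp_root_of_unity:
  fixes w :: complex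
  assumes "prim_root M w" "eps \<in> int_adjoin w" "norm eps = 1"
  obtains L where "L > 0" "eps ^ L = 1"
proof -
  have "norm (galois w t (eps ^ j)) \<le> 1" if "coprime t M" for t j
  proof -
    interpret cyclotomic_automorphism M w t using assms(1) that by unfold_locales
    have "(norm (galois w t eps))\<^sup>2 = of_nat 1"
      using assms that by (intro norm_power2_galois[OF assms(1)]) auto
    then have "norm (galois w t eps) = 1" by (simp add: power2_eq_1_iff) (smt (verit) norm_ge_zero)
    then show ?thesis using assms(2) by (simp add: norm_power)
  qed
  then have "range (\<lambda>j. eps ^ j) \<subseteq> {x \<in> int_adjoin w. \<forall>t. coprime t M \<longrightarrow> norm (galois w t x) \<le> 1}"
    using assms(2) by auto
  then have "finite (range (\<lambda>j. eps ^ j))"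
    using finite_int_adjoin_bounded_conjugates[OF assms(1)] finite_subset by blast
  then have "\<not> inj (\<lambda>j. eps ^ j)" using finite_imageD infinite_UNIV_nat by blast
  then obtain i j where collision: "eps ^ i = eps ^ j" "i < j"
    unfolding inj_def by (metis linorder_neqE_nat)
  have "eps ^ j = eps ^ i * eps ^ (j - i)" using collision(2) by (simp flip: power_add)
  moreover have "eps \<noteq> 0" using assms(3) by auto
  ultimately have "eps ^ (j - i) = 1" using collision(1) by simp
  then show ?thesis using that[of "j - i"] collision(2) by simp
qed

lemma exists_not_dvd_one_plus_mult:
  fixes l u :: nat
  assumes "prime l" "even u"
  obtains j where "\<not> l dvd j" "\<not> l dvd 1 + j * u"
proof (cases "l dvd 1 + 1 * u")
  case True
  then have "\<not> l dvd u" using assms(1) by (metis dvd_add_left_iff mult_1 not_prime_unit)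
  then have "\<not> l dvd 2" using assms(2) primes_dvd_imp_eq[OF assms(1) two_is_prime_nat] by blast
  moreover have "\<not> l dvd 1 + 2 * u"
    using True \<open>\<not> l dvd u\<close> dvd_add_right_iff[of l "1 + u" u] by (simp add: mult_2)
  ultimately show ?thesis using that by blast
next
  case False
  then show ?thesis using that[of 1] assms(1) by auto
qed

lemma exists_coprime_cong_1:
  fixes M K :: nat
  assumes "even M" "M dvd K" "M \<noteq> K" "K > 0"
  obtains t where "coprime t K" "[t = 1] (mod M)" "\<not> [t = 1] (mod K)"
proof -
  obtain i where "K = M * i" using assms(2) by (elim dvdE)
  then have "i \<noteq> 1" using assms(3) by simp
  then obtain l where "prime l" "l dvd i" using prime_factor_nat by blast
  then obtain r where "i = l * r" by (elim dvdE)
  define u where "u = M * r"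
  have K_eq: "K = l * u" by (simp add: \<open>K = M * i\<close> \<open>i = l * r\<close> u_def)
  have "u > 0" using assms(4) K_eq by simp
  have "even u" using assms(1) by (simp add: u_def)
  then obtain j where not_dvd: "\<not> l dvd j" "\<not> l dvd 1 + j * u"
    using exists_not_dvd_one_plus_mult \<open>prime l\<close> by blast
  show ?thesis
  proof (rule that[of "1 + j * u"])
    show "[1 + j * u = 1] (mod M)"
      by (simp only: cong_add_lcancel_0_nat cong_0_iff) (simp add: u_def)
    show "\<not> [1 + j * u = 1] (mod K)"
      using not_dvd(1) \<open>u > 0\<close> by (simp only: K_eq cong_add_lcancel_0_nat cong_0_iff) simp
    show "coprime (1 + j * u) K"
      unfolding coprime_nat_iff_no_common_prime
    proof (intro allI impI notI)
      fix p assume common: "prime p" "p dvd 1 + j * u" "p dvd K"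
      then have "p dvd u"
        using not_dvd(2) \<open>prime l\<close> by (metis K_eq primes_dvd_imp_eq prime_dvd_mult_iff)
      then have "p dvd 1" using common(2) by (metis dvd_add_left_iff dvd_mult)
      then show False using common(1) by simp
    qed
  qed
qed

lemma root_of_unity_int_adjoin_even:
  fixes w :: complex
  assumes "prim_root M w" "even M" "eps \<in> int_adjoin w" "eps ^ L = 1" "L > 0"
  shows "eps ^ M = 1"
proof -
  obtain k where "eps = zeta L ^ k"
    using root_of_unity_eq_power[OF prim_root_zeta assms(4)] assms(5) by blast
  then obtain d where order_eps: "prim_root d eps"
    using prim_root_power[OF prim_root_zeta, of L k] assms(5) by blast
  define K where "K = lcm M d"
  have "K > 0"
    using prim_rootD(1)[OF assms(1)] prim_rootD(1)[OF order_eps] by (simp add: K_def lcm_pos_nat)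
  have "K = M"
  proof (rule ccontr)
    assume "K \<noteq> M"
    then obtain t where exponent: "coprime t K" "[t = 1] (mod M)" "\<not> [t = 1] (mod K)"
      using exists_coprime_cong_1[of M K] assms(2) \<open>K > 0\<close> by (metis K_def dvd_lcm1)
    interpret cyclotomic_automorphism K "zeta K" t
      using exponent(1) \<open>K > 0\<close> by unfold_locales (rule prim_root_zeta)
    have "w ^ K = 1" "eps ^ K = 1"
      by (simp_all add: prim_rootD(3)[OF assms(1)] prim_rootD(3)[OF order_eps] K_def)
    note galois = this[THEN galois_root_of_unity]
      and in_adjoin = this[THEN root_of_unity_in_int_adjoin]
    obtain P where eps_eq: "eps = ipoly P w" using assms(3) by (elim int_adjoinE)
    have "eps ^ t = ipoly P (w ^ t)"
      using galois_ipoly_compose[OF in_adjoin(1), of P] galois by (simp flip: eps_eq)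
    also have "w ^ t = w ^ 1" using exponent(2) by (simp only: prim_root_power_eq_iff[OF assms(1)])
    finally have "eps ^ t = eps ^ 1" by (simp add: eps_eq)
    then have "[t = 1] (mod d)" by (simp only: prim_root_power_eq_iff[OF order_eps])
    then show False using exponent(2,3) cong_cong_lcm_nat unfolding K_def by blast
  qed
  then have "d dvd M" by (metis K_def dvd_lcm2)
  then show ?thesis by (simp add: prim_rootD(3)[OF order_eps])
qed

lemma int_adjoin_norm_1_eq_signed_power:
  fixes w :: complex
  assumes "prim_root M w" "eps \<in> int_adjoin w" "norm eps = 1"
  obtains s :: int and k where "s = 1 \<or> odd M \<and> s = -1" "eps = of_int s * w ^ k"
proof -
  obtain L where root_of_unity: "L > 0" "eps ^ L = 1"
    using int_adjoin_norm_1_imp_root_of_unity[OF assms] by blast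
  show ?thesis
  proof (cases "even M")
    case True
    then have "eps ^ M = 1" using root_of_unity_int_adjoin_even assms root_of_unity by blast
    then show ?thesis using root_of_unity_eq_power[OF assms(1)] that[of 1] by auto
  next
    case False
    have minus: "prim_root (2 * M) (- w)" using assms(1) False by (rule prim_root_uminus)
    have "w \<in> int_adjoin (- w)" using int_adjoin_uminus[OF int_adjoin_self, of "- w"] by simp
    then have "eps \<in> int_adjoin (- w)" using assms(2) by (metis int_adjoinE int_adjoin_ipoly)
    then have "eps ^ (2 * M) = 1"
      using root_of_unity_int_adjoin_even[OF minus] root_of_unity by simp
    then obtain k where "eps = (- w) ^ k" using root_of_unity_eq_power[OF minus] by blast
    then have "eps = of_int ((-1) ^ k) * w ^ k" by (simp flip: power_mult_distrib)
    then show ?thesis using that[of "(-1) ^ k" k] False by (cases "even k") auto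
  qed
qed

section \<open>The primes above a rational prime\<close>

lemma one_minus_prim_root_associated:
  fixes x :: "'a::idom"
  assumes "prim_root N x" "x \<in> int_adjoin w" "coprime j N"
  shows "1 - x \<in> pideal w (1 - x ^ j)"
proof -
  obtain i where "[j * i = 1] (mod N)" using cong_solve_coprime_nat[OF assms(3)] by auto
  then have "(x ^ j) ^ i = x ^ 1"
    unfolding power_mult[symmetric] prim_root_power_eq_iff[OF assms(1)] .
  then show ?thesis using one_minus_power_in_pideal[of "x ^ j" w i] assms(2) by auto
qed

lemma prod_linear_prim_root_not_dvd:
  fixes x :: "'a::idom"
  assumes "q > 0" "prim_root (N * q) x"
  shows "(\<Prod>j | j < N * q \<and> \<not> q dvd j. [:- (x ^ j), 1:]) = (\<Sum>i<q. monom 1 N ^ i)"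
    (is "?A = _")
proof -
  define B where "B = (\<Prod>j<N. [:- ((x ^ q) ^ j), 1:])"
  have B_eq: "B = monom 1 N - 1"
    unfolding B_def using assms(2) by (intro prod_linear_prim_root prim_root_power_dvd)
  have "B = (\<Prod>j | j < N * q \<and> q dvd j. [:- (x ^ j), 1:])"
    unfolding B_def
    by (rule prod.reindex_bij_witness[of _ "\<lambda>j. j div q" "\<lambda>j. j * q"])
      (use assms(1) in \<open>auto simp: power_mult[symmetric] mult.commute less_mult_imp_div_less\<close>)
  then have "?A * B = (\<Prod>j\<in>{j. j < N * q \<and> \<not> q dvd j} \<union> {j. j < N * q \<and> q dvd j}. [:- (x ^ j), 1:])"
    by (subst prod.union_disjoint) auto
  also have "{j. j < N * q \<and> \<not> q dvd j} \<union> {j. j < N * q \<and> q dvd j} = {..<N * q}" by auto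
  also have "(\<Prod>j<N * q. [:- (x ^ j), 1:]) = monom 1 N ^ q - 1"
    by (simp add: prod_linear_prim_root[OF assms(2)] monom_power)
  also have "\<dots> = (\<Sum>i<q. monom 1 N ^ i) * B"
    by (simp only: B_eq power_diff_1_eq mult.commute)
  finally have "?A * B = (\<Sum>i<q. monom 1 N ^ i) * B" .
  moreover have "B \<noteq> 0" unfolding B_def by (auto simp: prod_zero_iff)
  ultimately show ?thesis by simp
qed

lemma prod_one_minus_prim_root:
  fixes x :: "'a::idom"
  assumes "prime q" "prim_root (q ^ Suc c) x"
  shows "(\<Prod>j | j < q ^ Suc c \<and> \<not> q dvd j. 1 - x ^ j) = of_nat q"
proof -
  have "(\<Prod>j | j < q ^ c * q \<and> \<not> q dvd j. [:- (x ^ j), 1:]) = (\<Sum>i<q. monom 1 (q ^ c) ^ i)"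
    using assms prime_gt_0_nat by (intro prod_linear_prim_root_not_dvd) (simp_all add: mult.commute)
  then have "poly (\<Prod>j | j < q ^ c * q \<and> \<not> q dvd j. [:- (x ^ j), 1:]) 1
      = poly (\<Sum>i<q. monom 1 (q ^ c) ^ i) 1"
    by simp
  then show ?thesis by (simp add: poly_prod poly_sum poly_monom mult.commute)
qed

lemma prime_associated_power_one_minus_prim_root:
  fixes x :: "'a::idom"
  assumes "prime q" "prim_root (q ^ Suc c) x" "x \<in> int_adjoin w"
  obtains e where "e > 0" "of_nat q \<in> pideal w ((1 - x) ^ e)" "(1 - x) ^ e \<in> pideal w (of_nat q)"
proof -
  define J where "J = {j. j < q ^ Suc c \<and> \<not> q dvd j}"
  have coprime: "coprime j (q ^ Suc c)" if "j \<in> J" for j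
    using that assms(1) prime_imp_coprime[of q j] unfolding J_def
    by (simp add: coprime_commute del: power_Suc)
  have prod: "(\<Prod>j\<in>J. 1 - x ^ j) = of_nat q"
    unfolding J_def by (rule prod_one_minus_prim_root[OF assms(1,2)])
  show ?thesis
  proof (rule that[of "card J"])
    have "1 < q ^ Suc c" using prime_gt_1_nat[OF assms(1)] by (intro one_less_power) auto
    then have "1 \<in> J" using not_prime_unit assms(1) by (auto simp: J_def simp del: power_Suc)
    moreover have "finite J" by (simp add: J_def)
    ultimately show "card J > 0" using card_gt_0_iff by blast
    have "(\<Prod>j\<in>J. 1 - x ^ j) \<in> pideal w (\<Prod>j\<in>J. 1 - x)"
      by (intro pideal_prod one_minus_power_in_pideal assms)
    then show "of_nat q \<in> pideal w ((1 - x) ^ card J)" by (simp add: prod)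
    have "(\<Prod>j\<in>J. 1 - x) \<in> pideal w (\<Prod>j\<in>J. 1 - x ^ j)"
      by (intro pideal_prod one_minus_prim_root_associated[OF assms(2,3)] coprime)
    then show "(1 - x) ^ card J \<in> pideal w (of_nat q)" by (simp add: prod)
  qed
qed

lemma power_cong_mod_one_minus_power:
  assumes "[i = j] (mod N)"
  shows "[w ^ i = w ^ j] (mod 1 - w ^ N over w)"
proof -
  have absorb: "[w ^ k * (w ^ N) ^ l = w ^ k] (mod 1 - w ^ N over w)" for k l
  proof -
    have "w ^ k * (1 - (w ^ N) ^ l) \<in> pideal w (1 - w ^ N)"
      by (intro pideal_mult_left one_minus_power_in_pideal) auto
    then have "[w ^ k = w ^ k * (w ^ N) ^ l] (mod 1 - w ^ N over w)"
      by (simp add: adjoin_cong_def right_diff_distrib)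
    then show ?thesis by (rule adjoin_cong_sym)
  qed
  obtain k l where "j + k * N = i + l * N" using assms by (auto simp: cong_iff_lin_nat)
  then have "w ^ j * (w ^ N) ^ k = w ^ i * (w ^ N) ^ l"
    by (simp add: mult.commute flip: power_add power_mult)
  then show ?thesis using absorb[of j k] absorb[of i l] by (metis adjoin_cong_sym adjoin_cong_trans)
qed

lemma ipoly_power_cong_frobenius:
  assumes "prime q" "of_nat q \<in> pideal w (1 - w ^ N)" "[t = q ^ f] (mod N)"
  shows "[ipoly P (w ^ t) = ipoly P w ^ (q ^ f)] (mod 1 - w ^ N over w)"
proof -
  have "[ipoly P (w ^ t) = ipoly P (w ^ (q ^ f))] (mod 1 - w ^ N over w)"
    using power_cong_mod_one_minus_power[OF assms(3)] by (rule adjoin_cong_ipoly) auto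
  also have "[ipoly P (w ^ (q ^ f)) = ipoly P w ^ (q ^ f)] (mod 1 - w ^ N over w)"
    by (rule adjoin_cong_sym[OF adjoin_cong_modulus[OF frobenius_power_cong[OF assms(1)] assms(2)]])
  finally show ?thesis .
qed

lemma power_totient_cong:
  assumes "prime q" "of_nat q \<in> pideal w (1 - w ^ N)" "coprime q N" "x \<in> int_adjoin w"
  shows "[x ^ (q ^ totient N) = x] (mod 1 - w ^ N over w)"
proof -
  have "[1 = q ^ totient N] (mod N)" using euler_theorem[OF assms(3)] by (rule cong_sym)
  moreover obtain P where "x = ipoly P w" using assms(4) by (elim int_adjoinE)
  ultimately show ?thesis
    using ipoly_power_cong_frobenius[OF assms(1,2), of 1 "totient N" P]
    by (auto intro: adjoin_cong_sym)
qed

lemma power_totient_minus_1_idempotent: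
  assumes "prime q" "of_nat q \<in> pideal w (1 - w ^ N)" "coprime q N" "N > 0"
    and "x \<in> int_adjoin w" "k > 0"
  shows "[(x ^ (q ^ totient N - 1)) ^ k = x ^ (q ^ totient N - 1)] (mod 1 - w ^ N over w)"
proof (rule adjoin_cong_idempotent_power)
  define s where "s = q ^ totient N - 1"
  have "q ^ totient N > 1"
    using prime_gt_1_nat[OF assms(1)] assms(4) by (intro one_less_power) simp_all
  then have s_eq: "s > 0" "q ^ totient N = Suc s" by (simp_all add: s_def)
  have "[x ^ (s - 1) * (x * x ^ s) = x ^ (s - 1) * x] (mod 1 - w ^ N over w)"
    using power_totient_cong[OF assms(1-3,5)] assms(5)
    by (intro adjoin_cong_scalar_left) (auto simp: s_eq(2))
  moreover have "x ^ (s - 1) * x = x ^ s" using s_eq(1) by (rule power_minus_mult)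
  ultimately have "[(x ^ s)\<^sup>2 = x ^ s] (mod 1 - w ^ N over w)"
    by (simp only: power2_eq_square flip: mult.assoc)
  then show "[(x ^ (q ^ totient N - 1))\<^sup>2 = x ^ (q ^ totient N - 1)] (mod 1 - w ^ N over w)"
    by (simp only: s_def)
qed (use assms(5,6) in auto)

lemma pideal_power_quotient:
  fixes d :: "'a::idom"
  assumes "x * y \<in> pideal w (d ^ Suc B)" "x - x * u = d * x'" "u \<in> int_adjoin w" "d \<noteq> 0"
  shows "x' * y \<in> pideal w (d ^ B)"
proof -
  have "d * (x' * y) = (1 - u) * (x * y)"
    unfolding mult.assoc[symmetric] assms(2)[symmetric] by (simp add: algebra_simps)
  also have "\<dots> \<in> pideal w (d * d ^ B)"
    using pideal_mult_left[OF assms(1), of "1 - u"] assms(3) by simp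
  finally show ?thesis by (rule pideal_cancel) (rule assms(4))
qed

lemma pideal_mult_cong_power:
  assumes "[u = x ^ K] (mod d over w)" "K > 0" "x * y \<in> pideal w d"
    and "x \<in> int_adjoin w" "y \<in> int_adjoin w"
  shows "u * y \<in> pideal w d"
proof -
  have "[u * y = x ^ K * y] (mod d over w)"
    using adjoin_cong_scalar_left[OF assms(1,5)] by (simp add: mult.commute)
  also have "x ^ K * y = x ^ (K - 1) * (x * y)"
    using assms(2) by (simp add: power_eq_if mult_ac)
  also have "[\<dots> = 0] (mod d over w)"
    using pideal_mult_left[OF assms(3)] assms(4) by (simp add: adjoin_cong_0_iff)
  finally show ?thesis by (simp only: adjoin_cong_0_iff)
qed

context cyclotomic_automorphism
begin

text \<open>The power \<open>x\<^sup>K\<close> approximates the idempotent that is 1 at the primes above \<open>q\<close> not dividing \<open>x\<close>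
  and 0 at the others. The automorphism preserves it, because modulo \<open>1 - w\<^sup>N\<close> it acts as a power of
  the Frobenius, which fixes idempotents.\<close>

lemma galois_approximate_idempotent:
  assumes "prime q" "of_nat q \<in> pideal w (1 - w ^ N)" "coprime q N" "N > 0" "[t = q ^ f] (mod N)"
  obtains K where "K > 0"
    "\<And>x. x \<in> int_adjoin w \<Longrightarrow> [x ^ Suc K = x] (mod 1 - w ^ N over w)"
    "\<And>x. x \<in> int_adjoin w \<Longrightarrow> [galois w t x ^ K = x ^ K] (mod (1 - w ^ N) ^ Suc B over w)"
proof -
  define s where "s = q ^ totient N - 1"
  have "q > 1" using assms(1) by (rule prime_gt_1_nat)
  then have "q ^ totient N > 1" using assms(4) by (intro one_less_power) simp_all
  then have "s > 0" by (simp add: s_def)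
  note fixed = power_totient_cong[OF assms(1-3)]
    and idempotent = power_totient_minus_1_idempotent[OF assms(1-4), folded s_def]
  have s_eq: "q ^ totient N = Suc s" using \<open>s > 0\<close> by (simp add: s_def)
  show ?thesis
  proof (rule that[of "s * q ^ B"])
    show "s * q ^ B > 0" using \<open>s > 0\<close> \<open>q > 1\<close> by simp
    fix x assume in_adjoin: "x \<in> int_adjoin w"
    have "[x * (x ^ s) ^ (q ^ B) = x * x ^ s] (mod 1 - w ^ N over w)"
      using idempotent[OF in_adjoin] in_adjoin \<open>q > 1\<close> by (intro adjoin_cong_scalar_left) auto
    also have "[x * x ^ s = x] (mod 1 - w ^ N over w)" using fixed[OF in_adjoin] by (simp add: s_eq)
    finally show "[x ^ Suc (s * q ^ B) = x] (mod 1 - w ^ N over w)" by (simp add: power_mult)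
    obtain P where "x = ipoly P w" using in_adjoin by (elim int_adjoinE)
    then have "[galois w t x = x ^ (q ^ f)] (mod 1 - w ^ N over w)"
      using ipoly_power_cong_frobenius[OF assms(1,2,5)] by (simp add: galois_ipoly)
    then have "[galois w t x ^ s = (x ^ (q ^ f)) ^ s] (mod 1 - w ^ N over w)"
      using in_adjoin by (intro adjoin_cong_power) auto
    also have "(x ^ (q ^ f)) ^ s = (x ^ s) ^ (q ^ f)" by (simp add: mult.commute flip: power_mult)
    also have "[\<dots> = x ^ s] (mod 1 - w ^ N over w)"
      using in_adjoin \<open>q > 1\<close> by (intro idempotent) auto
    finally have "[galois w t x ^ s = x ^ s] (mod 1 - w ^ N over w)" .
    then have "[(galois w t x ^ s) ^ (q ^ B) = (x ^ s) ^ (q ^ B)] (mod (1 - w ^ N) ^ Suc B over w)"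
      using in_adjoin assms(2) by (intro adjoin_cong_lift_prime_power) auto
    then show "[galois w t x ^ (s * q ^ B) = x ^ (s * q ^ B)] (mod (1 - w ^ N) ^ Suc B over w)"
      by (simp add: power_mult)
  qed
qed

text \<open>Where the approximate idempotent \<open>x\<^sup>K\<close> vanishes, a factor \<open>1 - w\<^sup>N\<close> splits off from \<open>x\<close>, and
  the induction hypothesis applies to the quotient.\<close>

lemma galois_mult_in_pideal_power:
  assumes "prime q" "of_nat q \<in> pideal w (1 - w ^ N)" "coprime q N" "N > 0" "[t = q ^ f] (mod N)"
    and "w ^ N \<noteq> 1" "x \<in> int_adjoin w" "y \<in> int_adjoin w"
  shows "x * y \<in> pideal w ((1 - w ^ N) ^ B) \<Longrightarrow> galois w t x * y \<in> pideal w ((1 - w ^ N) ^ B)"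
  using assms(7)
proof (induction B arbitrary: x)
  case 0
  then show ?case using assms(8) by simp
next
  case (Suc B)
  define d z where "d = 1 - w ^ N" and "z = galois w t x"
  have "d \<in> int_adjoin w" "d \<noteq> 0" using assms(6) by (auto simp: d_def)
  have in_adjoin: "x \<in> int_adjoin w" "z \<in> int_adjoin w" using Suc.prems by (auto simp: z_def)
  have multiple: "x * y \<in> pideal w (d ^ Suc B)" using Suc.prems by (simp add: d_def)
  obtain K where approximate_idempotent: "K > 0" "[x ^ Suc K = x] (mod d over w)"
      "[z ^ K = x ^ K] (mod d ^ Suc B over w)"
    using galois_approximate_idempotent[OF assms(1-5)] in_adjoin(1) unfolding d_def z_def by metis
  have "x - x * x ^ K \<in> pideal w d"
    using adjoin_cong_sym[OF approximate_idempotent(2)] by (simp add: adjoin_cong_def)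
  then obtain x' where quotient: "x' \<in> int_adjoin w" "x - x * x ^ K = d * x'" by (elim pidealE)
  have "x' * y \<in> pideal w (d ^ B)"
    using multiple quotient(2) _ \<open>d \<noteq> 0\<close> by (rule pideal_power_quotient) (use in_adjoin in simp)
  then have "galois w t x' * y \<in> pideal w (d ^ B)" using Suc.IH quotient(1) by (simp add: d_def)
  moreover have "galois w t d \<in> pideal w d"
    using one_minus_power_in_pideal[of "w ^ N" w t]
    by (simp add: d_def galois_generator mult.commute flip: power_mult)
  ultimately have "galois w t d * (galois w t x' * y) \<in> pideal w (d * d ^ B)"
    by (intro pideal_mult)
  moreover have "z - z * z ^ K = galois w t (d * x')"
    using in_adjoin by (simp add: z_def flip: quotient(2))
  ultimately have "(z - z * z ^ K) * y \<in> pideal w (d ^ Suc B)"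
    using quotient(1) \<open>d \<in> int_adjoin w\<close> by (simp add: mult.assoc)
  moreover have "z * (z ^ K * y) \<in> pideal w (d ^ Suc B)"
    using pideal_mult_cong_power[OF approximate_idempotent(3,1) multiple in_adjoin(1) assms(8)] in_adjoin(2)
    by (rule pideal_mult_left)
  ultimately have "(z - z * z ^ K) * y + z * (z ^ K * y) \<in> pideal w (d ^ Suc B)"
    by (rule pideal_add)
  then show ?case by (simp add: algebra_simps z_def d_def)
qed

end

text \<open>The exponents \<open>t\<close> for which \<open>w \<mapsto> w\<^sup>t\<close> fixes the prime ideals above \<open>q\<close>, when \<open>w\<close> is a
  primitive \<open>M\<close>th root of unity.\<close>

definition decomposition_group :: "nat \<Rightarrow> nat \<Rightarrow> nat set" where
  "decomposition_group q M = {t. coprime t M \<and> (\<exists>f. [t = q ^ f] (mod M div q ^ multiplicity q M))}"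

lemma galois_mult_in_pideal_prime_power:
  fixes w :: "'a::field_char_0"
  assumes "prim_root M w" "prime q" "q dvd M" "t \<in> decomposition_group q M"
    and "x \<in> int_adjoin w" "y \<in> int_adjoin w" "x * y \<in> pideal w (of_nat (q ^ b))"
  shows "galois w t x * y \<in> pideal w (of_nat (q ^ b))"
proof -
  note root_props = prim_rootD[OF assms(1)]
  interpret cyclotomic_automorphism M w t
    using assms(1,4) by unfold_locales (auto simp: decomposition_group_def)
  define N where "N = M div q ^ multiplicity q M"
  obtain f where frobenius: "[t = q ^ f] (mod N)"
    using assms(4) by (auto simp: decomposition_group_def N_def)
  have M_eq: "M = q ^ multiplicity q M * N" by (simp add: N_def multiplicity_dvd)
  have "N > 0" using root_props(1) M_eq by (metis gr0I mult_0_right)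
  have "\<not> q dvd N"
    unfolding N_def using assms(2) root_props(1) by (intro multiplicity_decompose) auto
  then have "coprime q N" using assms(2) by (simp add: prime_imp_coprime)
  obtain c where multiplicity_eq: "multiplicity q M = Suc c"
    using assms(2,3) root_props(1)
    by (metis gr0_conv_Suc prime_multiplicity_gt_zero_iff prime_imp_prime_elem gr_implies_not0)
  have prim_root_wN: "prim_root (q ^ Suc c) (w ^ N)"
    using assms(1) M_eq by (intro prim_root_power_dvd) (simp add: multiplicity_eq)
  then have "w ^ N \<noteq> 1"
    using assms(2) prim_rootD(3)[OF prim_root_wN, of 1] by auto
  obtain e where associated: "e > 0" "of_nat q \<in> pideal w ((1 - w ^ N) ^ e)"
      "(1 - w ^ N) ^ e \<in> pideal w (of_nat q)"
    using prime_associated_power_one_minus_prim_root[OF assms(2) prim_root_wN] by blast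
  have "(1 - w ^ N) * (1 - w ^ N) ^ (e - 1) \<in> pideal w (1 - w ^ N)" by (intro pidealI) auto
  then have "of_nat q \<in> pideal w (1 - w ^ N)"
    using pideal_trans[OF associated(2)] associated(1) by (simp add: power_eq_if)
  moreover have "x * y \<in> pideal w ((1 - w ^ N) ^ (e * b))"
    using pideal_trans[OF assms(7)] pideal_power[OF associated(2), of b] by (simp add: power_mult)
  ultimately have "galois w t x * y \<in> pideal w ((1 - w ^ N) ^ (e * b))"
    using assms(2,5,6) \<open>coprime q N\<close> \<open>N > 0\<close> frobenius \<open>w ^ N \<noteq> 1\<close>
    by (intro galois_mult_in_pideal_power)
  then show ?thesis
    using pideal_trans pideal_power[OF associated(3), of b] by (simp add: power_mult)
qed

text \<open>An automorphism in all the decomposition groups at \<open>n\<close> fixes the ideals dividing \<open>n\<close>. So it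
  changes \<open>x\<close> only by a unit, all of whose conjugates have absolute value 1.\<close>

lemma galois_eq_signed_power_mult:
  fixes w :: complex
  assumes "prim_root M w" "n > 0" "coprime t M"
    and "\<And>q. prime q \<Longrightarrow> q dvd n \<Longrightarrow> q dvd M \<and> t \<in> decomposition_group q M"
    and "x \<in> int_adjoin w" "(norm x)\<^sup>2 = of_nat n"
  obtains s :: int and k where "s = 1 \<or> odd M \<and> s = -1" "galois w t x = of_int s * w ^ k * x"
proof -
  interpret cyclotomic_automorphism M w t using assms(1,3) by unfold_locales
  have cnj: "cnj x \<in> int_adjoin w" using assms(1,5) by (rule cnj_in_int_adjoin)
  have norm: "x * cnj x = of_nat n" using assms(6) by (simp only: norm_power2_eq_of_nat_iff)
  have "galois w t x * cnj x \<in> pideal w (of_nat n)"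
  proof (rule pideal_prime_powersI[OF assms(2)])
    fix q assume prime_q: "prime q" "q dvd n"
    have "x * cnj x \<in> pideal w (of_nat (q ^ multiplicity q n))"
      unfolding norm by (intro pideal_of_nat multiplicity_dvd)
    then show "galois w t x * cnj x \<in> pideal w (of_nat (q ^ multiplicity q n))"
      using assms(1,4,5) prime_q cnj by (intro galois_mult_in_pideal_prime_power[of M]) auto
  qed (use assms(5) cnj in simp)
  then obtain eps where quotient: "eps \<in> int_adjoin w" "galois w t x * cnj x = of_nat n * eps"
    by (elim pidealE)
  have "x \<noteq> 0" using norm assms(2) by auto
  have "galois w t x * (x * cnj x) = of_nat n * (eps * x)" using quotient(2) by (simp add: mult_ac)
  then have galois: "galois w t x = eps * x" using assms(2) by (simp add: norm)
  have "(norm (galois w t x))\<^sup>2 = (norm x)\<^sup>2"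
    using norm_power2_galois[OF assms(1,3,5,6)] assms(6) by simp
  then have "norm eps = 1" using \<open>x \<noteq> 0\<close> by (simp add: galois norm_mult)
  then show ?thesis
    using int_adjoin_norm_1_eq_signed_power[OF assms(1) quotient(1)] that galois by metis
qed

section \<open>Powers congruent to \<open>1 + N/p\<close>\<close>

lemma cong_1_power_prime_power:
  fixes a :: int and p :: nat
  assumes "[a = 1] (mod int p)"
  shows "[a ^ (p ^ k) = 1] (mod int p ^ Suc k)"
proof (induction k)
  case 0
  then show ?case using assms by simp
next
  case (Suc k)
  define b where "b = a ^ (p ^ k)"
  have "[b = 1 ^ (p ^ k)] (mod int p)" unfolding b_def using assms by (rule cong_pow)
  then have "[(\<Sum>i<p. b ^ i) = (\<Sum>i<p. 1 ^ i)] (mod int p)" by (intro cong_sum cong_pow) simp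
  then have "int p dvd (\<Sum>i<p. b ^ i)" by (simp add: cong_dvd_iff)
  moreover have "int p ^ Suc k dvd b - 1" using Suc by (simp add: b_def cong_iff_dvd_diff)
  ultimately have "int p ^ Suc k * int p dvd (b - 1) * (\<Sum>i<p. b ^ i)" by (intro mult_dvd_mono)
  then have "int p ^ Suc k * int p dvd b ^ p - 1" by (simp only: power_diff_1_eq)
  then show ?case by (simp add: b_def cong_iff_dvd_diff power_mult[symmetric] mult_ac)
qed

lemma one_plus_power_cong:
  fixes u :: int
  shows "[(1 + u) ^ e = 1 + int e * u] (mod u ^ 2)"
proof (induction e)
  case (Suc e)
  have "[(1 + u) * (1 + u) ^ e = (1 + u) * (1 + int e * u)] (mod u ^ 2)"
    using Suc by (rule cong_scalar_left)
  also have "(1 + u) * (1 + int e * u) = 1 + int (Suc e) * u + u ^ 2 * int e"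
    by (simp add: algebra_simps power2_eq_square)
  also have "[\<dots> = 1 + int (Suc e) * u] (mod u ^ 2)" by (simp add: cong_def)
  finally show ?case by simp
qed simp

lemma geometric_sum_cong_prime_square:
  fixes b :: int
  assumes "prime p" "[b = 1] (mod int p)" "p = 2 \<Longrightarrow> [b = 1] (mod 4)"
  shows "[(\<Sum>i<p. b ^ i) = int p] (mod (int p)\<^sup>2)"
proof (cases "p = 2")
  case True
  have "[1 + b = 1 + 1] (mod 4)" using assms(3)[OF True] by (intro cong_add) auto
  moreover have "(\<Sum>i<2. b ^ i) = 1 + b" by (simp add: numeral_2_eq_2)
  ultimately show ?thesis by (simp add: True)
next
  case False
  then have "odd p" using prime_ge_2_nat[OF assms(1)] prime_odd_nat[OF assms(1)] by simp
  then obtain r where p_eq: "p = 2 * r + 1" by (elim oddE)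
  obtain y where b_eq: "b = 1 + int p * y" using assms(2) by (metis cong_iff_lin cong_sym)
  have "[b ^ i = 1 + int i * (int p * y)] (mod (int p)\<^sup>2)" for i
    using one_plus_power_cong[of "int p * y" i] unfolding b_eq
    by (rule cong_dvd_modulus) (simp add: power_mult_distrib)
  then have "[(\<Sum>i<p. b ^ i) = (\<Sum>i<p. 1 + int i * (int p * y))] (mod (int p)\<^sup>2)"
    by (intro cong_sum)
  also have "(\<Sum>i<p. 1 + int i * (int p * y)) = int p + int (\<Sum>i<p. i) * (int p * y)"
    by (simp add: sum.distrib sum_distrib_right)
  also have "(\<Sum>i<p. i) = p * r"
    using Sum_Ico_nat[of 0 p] by (simp add: p_eq lessThan_atLeast0)
  also have "int p + int (p * r) * (int p * y) = int p + (int p)\<^sup>2 * (int r * y)"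
    by (simp add: power2_eq_square)
  also have "[\<dots> = int p] (mod (int p)\<^sup>2)" by (simp add: cong_def)
  finally show ?thesis .
qed

lemma geometric_sum_eq_prime_times_coprime:
  fixes b :: int and N p :: nat
  assumes "prime p" "p dvd N" "\<And>l. prime l \<Longrightarrow> l dvd N \<Longrightarrow> [b = 1] (mod int l)"
    and "p = 2 \<Longrightarrow> [b = 1] (mod 4)"
  obtains S where "(\<Sum>i<p. b ^ i) = int p * S" "coprime S (int N)"
proof -
  have mod_square: "[(\<Sum>i<p. b ^ i) = int p] (mod int p * int p)"
    using geometric_sum_cong_prime_square[of p b] assms by (simp add: power2_eq_square)
  then have "int p dvd (\<Sum>i<p. b ^ i)" by (metis cong_dvd_iff cong_modulus_mult dvd_refl)
  then obtain S where sum_eq: "(\<Sum>i<p. b ^ i) = int p * S" by (elim dvdE)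
  have "\<not> int l dvd S" if "prime l" "l dvd N" for l
  proof (cases "l = p")
    case True
    have "int p * int p dvd int p * (S - 1)"
      using mod_square by (simp add: sum_eq cong_iff_dvd_diff right_diff_distrib)
    then have "int p dvd S - 1" using assms(1) by (simp add: prime_gt_0_nat)
    then have "[S = 1] (mod int p)" by (simp add: cong_iff_dvd_diff)
    then have "int p dvd S \<longleftrightarrow> int p dvd 1" by (rule cong_dvd_iff)
    then show ?thesis using True assms(1) not_prime_unit[of p] by auto
  next
    case False
    have "[(\<Sum>i<p. b ^ i) = (\<Sum>i<p. 1 ^ i)] (mod int l)"
      using assms(3)[OF that] by (intro cong_sum cong_pow)
    then have "int l dvd int p * S \<longleftrightarrow> int l dvd int p" by (simp add: sum_eq cong_dvd_iff)
    moreover have "\<not> l dvd p" using primes_dvd_imp_eq[OF that(1) assms(1)] False by blast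
    ultimately show ?thesis by auto
  qed
  then have "coprime (nat \<bar>S\<bar>) N"
    unfolding coprime_nat_iff_no_common_prime by auto
  then show ?thesis by (intro that[OF sum_eq]) simp
qed

lemma cong_1_div_prime:
  fixes b :: int and N p :: nat
  assumes "prime p" "p dvd N" "\<And>l. prime l \<Longrightarrow> l dvd N \<Longrightarrow> [b = 1] (mod int l)"
    and "p = 2 \<Longrightarrow> [b = 1] (mod 4)" "[b ^ p = 1] (mod int N)"
  shows "[b = 1] (mod int (N div p))"
proof -
  obtain S where cofactor: "(\<Sum>i<p. b ^ i) = int p * S" "coprime S (int N)"
    using geometric_sum_eq_prime_times_coprime[of p N b] assms by blast
  have "int N dvd (b - 1) * (\<Sum>i<p. b ^ i)"
    using assms(5) by (simp add: cong_iff_dvd_diff power_diff_1_eq)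
  then have "int N dvd int p * (b - 1) * S" by (simp add: cofactor(1) mult_ac)
  then have "int N dvd int p * (b - 1)"
    using cofactor(2) by (simp add: coprime_dvd_mult_left_iff coprime_commute)
  moreover have "int N = int p * int (N div p)" using assms(2) by (simp flip: of_nat_mult)
  ultimately show ?thesis using assms(1) by (simp add: cong_iff_dvd_diff prime_gt_0_nat)
qed

lemma prime_dvd_ord:
  fixes a N p :: nat
  assumes "prime p" "p ^ Suc v dvd N" "[a = 1] (mod p)" "\<not> [a = 1] (mod p ^ Suc v)"
  shows "p dvd ord N a"
proof (rule ccontr)
  assume "\<not> p dvd ord N a"
  then have "coprime (p ^ v) (ord N a)" using assms(1) by (simp add: prime_imp_coprime)
  moreover have "ord (p ^ Suc v) a dvd ord N a"
    using cong_dvd_modulus_nat[OF ord assms(2)] by (simp only: ord_divides)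
  moreover have "ord (p ^ Suc v) a dvd p ^ v"
  proof -
    have "[int a = 1] (mod int p)" using assms(3) by (metis cong_int_iff of_nat_1)
    then have "[int a ^ (p ^ v) = 1] (mod int p ^ Suc v)" by (rule cong_1_power_prime_power)
    then have "[a ^ (p ^ v) = 1] (mod p ^ Suc v)"
      by (metis cong_int_iff of_nat_1 of_nat_power)
    then show ?thesis by (simp only: ord_divides)
  qed
  ultimately have "ord (p ^ Suc v) a dvd 1" by (metis coprime_common_divisor)
  then have "[a ^ 1 = 1] (mod p ^ Suc v)" by (simp only: ord_divides)
  then show False using assms(4) by simp
qed

lemma exists_power_cong_one_plus_multiple:
  fixes b N p r :: nat
  assumes "prime p" "p\<^sup>2 dvd N" "[b = 1] (mod N div p)" "\<not> [b = 1] (mod N)"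
  obtains e where "[b ^ e = 1 + (N div p) * r] (mod N)"
proof -
  define N' where "N' = N div p"
  have "p dvd N" using assms(2) by (metis dvd_mult_left power2_eq_square)
  then have N_eq: "N = p * N'" by (simp add: N'_def)
  have "p dvd N'" using assms(1,2) by (simp add: N_eq power2_eq_square prime_gt_0_nat)
  have "int N' dvd int b - 1"
    using assms(3) by (metis N'_def cong_iff_dvd_diff cong_int_iff of_nat_1)
  then obtain j where b_eq: "int b = 1 + int N' * j" by (metis add.commute diff_add_cancel dvdE)
  have "\<not> int p dvd j"
  proof
    assume "int p dvd j"
    then have "int N dvd int b - 1" by (simp add: b_eq N_eq mult.commute)
    then have "[b = 1] (mod N)" by (metis cong_iff_dvd_diff cong_int_iff of_nat_1)
    then show False using assms(4) by blast
  qed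
  then have "coprime j (int p)"
    using assms(1) prime_imp_coprime[of "int p" j] by (simp add: coprime_commute)
  then obtain x where inverse: "[j * x = 1] (mod int p)" using cong_solve_coprime_int by blast
  define e where "e = nat ((x * int r) mod int p)"
  have e_eq: "int e = (x * int r) mod int p" using assms(1) by (simp add: e_def prime_gt_0_nat)
  have "[j * int e = j * (x * int r)] (mod int p)" unfolding e_eq by (intro cong_mult) auto
  also have "[j * (x * int r) = int r] (mod int p)"
    using cong_scalar_right[OF inverse, of "int r"] by (simp add: mult.assoc)
  finally have "[int N' * (j * int e) = int N' * int r] (mod int N' * int p)"
    by (rule cong_cmult_leftI)
  then have exponent: "[1 + int e * (int N' * j) = 1 + int N' * int r] (mod int N)"
    by (intro cong_add) (simp_all add: N_eq mult_ac)
  have "int N dvd (int N' * j)\<^sup>2"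
    using \<open>p dvd N'\<close> by (auto simp: N_eq power2_eq_square intro: mult_dvd_mono dvd_mult2)
  then have "[int b ^ e = 1 + int e * (int N' * j)] (mod int N)"
    unfolding b_eq by (rule cong_dvd_modulus[OF one_plus_power_cong])
  also note exponent
  finally have "[int (b ^ e) = int (1 + N' * r)] (mod int N)" by simp
  then show ?thesis using that by (simp only: cong_int_iff N'_def)
qed

text \<open>The witness \<open>a\<^sup>i\<close> is an element of order \<open>p\<close> of the group generated by \<open>a\<close>.\<close>

lemma exists_power_cong_1_div_prime:
  fixes a N p v :: nat
  assumes "prime p" "p ^ Suc v dvd N" "coprime a N"
    and "\<And>l. prime l \<Longrightarrow> l dvd N \<Longrightarrow> [a = 1] (mod l)" "p = 2 \<Longrightarrow> [a = 1] (mod 4)"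
    and "\<not> [a = 1] (mod p ^ Suc v)"
  obtains i where "[a ^ i = 1] (mod N div p)" "\<not> [a ^ i = 1] (mod N)"
proof -
  define i where "i = ord N a div p"
  have "p dvd N" using dvd_trans[OF _ assms(2), of p] by simp
  then have "p dvd ord N a" using assms by (intro prime_dvd_ord[of p v]) auto
  have "ord N a > 0" using assms(3) by (simp add: coprime_commute)
  have power_cong_1: "[int (a ^ i) = 1] (mod int l)" if "[a = 1] (mod l)" for l
    using cong_pow[OF that, of i] by (metis cong_int_iff of_nat_1 power_one)
  have "[(a ^ i) ^ p = 1] (mod N)"
    using ord[of a N] \<open>p dvd ord N a\<close> by (simp add: i_def flip: power_mult)
  then have "[int (a ^ i) ^ p = 1] (mod int N)" by (metis cong_int_iff of_nat_1 of_nat_power)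
  moreover have "[int (a ^ i) = 1] (mod int l)" if "prime l" "l dvd N" for l
    using assms(4)[OF that] by (rule power_cong_1)
  moreover have "[int (a ^ i) = 1] (mod 4)" if "p = 2"
    using power_cong_1[OF assms(5)[OF that]] by simp
  ultimately have "[int (a ^ i) = 1] (mod int (N div p))"
    using cong_1_div_prime[of p N "int (a ^ i)"] assms(1) \<open>p dvd N\<close> by blast
  then have "[a ^ i = 1] (mod N div p)" by (metis cong_int_iff of_nat_1)
  moreover have "\<not> [a ^ i = 1] (mod N)"
  proof (rule ord_minimal)
    show "0 < i"
      unfolding i_def using \<open>ord N a > 0\<close> \<open>p dvd ord N a\<close> by (metis dvd_div_eq_0_iff gr0I)
    show "i < ord N a"
      unfolding i_def using \<open>ord N a > 0\<close> prime_gt_1_nat[OF assms(1)] by simp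
  qed
  ultimately show ?thesis by (rule that)
qed

lemma exists_power_cong_one_plus:
  fixes a N p v r :: nat
  assumes "prime p" "p ^ Suc v dvd N" "coprime a N"
    and "\<And>l. prime l \<Longrightarrow> l dvd N \<Longrightarrow> [a = 1] (mod l)" "p = 2 \<Longrightarrow> [a = 1] (mod 4)"
    and "\<not> [a = 1] (mod p ^ Suc v)"
  obtains i where "[a ^ i = 1 + (N div p) * r] (mod N)"
proof -
  obtain j where "[a ^ j = 1] (mod N div p)" "\<not> [a ^ j = 1] (mod N)"
    using exists_power_cong_1_div_prime[OF assms] by blast
  moreover have "p\<^sup>2 dvd N"
  proof -
    have "[a = 1] (mod p)" using assms(4)[OF assms(1)] dvd_trans[OF _ assms(2), of p] by simp
    then have "v > 0" using assms(6) by (cases v) auto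
    then have "p\<^sup>2 dvd p ^ Suc v" by (intro le_imp_power_dvd) auto
    then show ?thesis using assms(2) by (rule dvd_trans)
  qed
  ultimately obtain i where "[(a ^ j) ^ i = 1 + (N div p) * r] (mod N)"
    using exists_power_cong_one_plus_multiple[OF assms(1)] by blast
  then show ?thesis using that by (simp flip: power_mult)
qed

lemma cong_1_mtilde_imp_cong_1_prime:
  assumes "[a = 1] (mod mtilde m q)" "prime l" "l dvd m" "l \<noteq> q" "m > 0"
  shows "[a = 1] (mod l)"
proof -
  have dvd_prod: "l dvd \<Prod>(prime_factors m - Q)" if "l \<notin> Q" for Q
    using assms that
    by (intro dvd_prodI[where f = "\<lambda>x. x", simplified]) (auto simp: prime_factors_dvd)
  have "l dvd mtilde m q"
    using dvd_prod[of "{q}"] dvd_prod[of "{2, q}"] assms(4)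
    by (cases "l = 2") (auto simp: mtilde_def)
  then show ?thesis using assms(1) cong_dvd_modulus_nat by blast
qed

lemma cong_1_mtilde_imp_cong_1_4:
  assumes "[a = 1] (mod mtilde m q)" "even m" "q \<noteq> 2"
  shows "[a = 1] (mod 4)"
proof -
  have "4 dvd mtilde m q" using assms(2,3) by (simp add: mtilde_def)
  then show ?thesis using assms(1) cong_dvd_modulus_nat by blast
qed

lemma coprime_one_plus_cofactor:
  fixes M p :: nat
  assumes "\<And>l. prime l \<Longrightarrow> l dvd M \<Longrightarrow> l dvd M div p"
  shows "coprime (1 + M div p) M"
  unfolding coprime_nat_iff_no_common_prime
proof (intro allI impI notI)
  fix l assume common_prime: "prime l" "l dvd 1 + M div p" "l dvd M"
  then have "l dvd M div p" using assms by blast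
  then have "l dvd 1" using common_prime(2) by (simp only: dvd_add_left_iff)
  then show False using common_prime(1) by simp
qed

lemma exists_prime_power_cong_one_plus_cofactor:
  assumes "prime p" "prime q" "q \<noteq> p" "M = q ^ c * N" "\<not> q dvd N" "M dvd m" "m > 0" "h * p dvd M"
    and noncong: "\<not> [q ^ ord (mtilde m q) q = 1] (mod p ^ (multiplicity p h + 1))"
  obtains f where "[1 + M div p = q ^ f] (mod N)"
proof -
  define a where "a = q ^ ord (mtilde m q) q"
  have cong_1: "[a = 1] (mod mtilde m q)" unfolding a_def by (rule ord)
  have dvd: "p ^ Suc (multiplicity p h) dvd N"
  proof -
    have "p ^ multiplicity p h * p dvd h * p" by (intro mult_dvd_mono multiplicity_dvd dvd_refl)
    then have "p ^ Suc (multiplicity p h) dvd q ^ c * N"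
      using assms(4,8) by (metis dvd_trans power_Suc2)
    moreover have "coprime (p ^ Suc (multiplicity p h)) (q ^ c)"
      using primes_coprime[OF assms(1,2)] assms(3) by simp
    ultimately show ?thesis by (simp add: coprime_dvd_mult_right_iff)
  qed
  moreover have "coprime a N" using assms(2,5) by (simp add: a_def prime_imp_coprime)
  moreover have "[a = 1] (mod l)" if "prime l" "l dvd N" for l
    using that assms(4-7)
    by (intro cong_1_mtilde_imp_cong_1_prime[OF cong_1]) (auto intro: dvd_trans)
  moreover have "[a = 1] (mod 4)" if "p = 2"
  proof (rule cong_1_mtilde_imp_cong_1_4[OF cong_1])
    show "even m" using that assms(6,8) by (meson dvd_mult_right dvd_trans)
  qed (use that assms(3) in blast)
  moreover have "\<not> [a = 1] (mod p ^ Suc (multiplicity p h))"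
    using noncong by (simp add: a_def)
  ultimately obtain f where power_cong: "[a ^ f = 1 + (N div p) * q ^ c] (mod N)"
    by (rule exists_power_cong_one_plus[OF assms(1)])
  have "p dvd N" using dvd by (rule dvd_trans[rotated]) simp
  then have "(N div p) * q ^ c = M div p" by (simp add: assms(4) div_mult_swap mult.commute)
  then have "[1 + M div p = q ^ (ord (mtilde m q) q * f)] (mod N)"
    using power_cong by (simp add: a_def power_mult cong_sym)
  then show ?thesis by (rule that)
qed

lemma one_plus_cofactor_in_decomposition_group:
  assumes "prime p" "prime q" "M dvd m" "m > 0" "h * p dvd M" "q dvd M"
    and radical: "\<And>l. prime l \<Longrightarrow> l dvd M \<Longrightarrow> l dvd h"
    and noncong: "q \<noteq> p \<Longrightarrow> \<not> [q ^ ord (mtilde m q) q = 1] (mod p ^ (multiplicity p h + 1))"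
  shows "1 + M div p \<in> decomposition_group q M"
proof -
  have "M > 0" using assms(3,4) by (meson dvd_pos_nat)
  have "p > 0" using assms(1) by (rule prime_gt_0_nat)
  have "h dvd M div p" using assms(5) \<open>p > 0\<close> by (metis dvd_mult_imp_div)
  then have "coprime (1 + M div p) M"
    using radical by (intro coprime_one_plus_cofactor) (meson dvd_trans)
  moreover obtain N where decomposition: "M = q ^ multiplicity q M * N" "\<not> q dvd N"
    using multiplicity_decompose'[of M q] assms(2) \<open>M > 0\<close> by (metis not_prime_unit gr_implies_not0)
  moreover have "\<exists>f. [1 + M div p = q ^ f] (mod N)"
  proof (cases "q = p")
    case True
    have "multiplicity q M > 0"
      using assms(2,6) \<open>M > 0\<close> by (simp add: prime_multiplicity_gt_zero_iff)
    then obtain c where "M = q * (q ^ c * N)"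
      using decomposition(1) by (metis gr0_conv_Suc mult.assoc power_Suc)
    then have "M div p = N * q ^ c" using True \<open>p > 0\<close> by (simp add: mult.commute)
    then have "[1 + M div p = q ^ 0] (mod N)" by (simp only: cong_def power_0 mod_mult_self2)
    then show ?thesis by blast
  next
    case False
    then show ?thesis
      using exists_prime_power_cong_one_plus_cofactor[OF assms(1,2) _ decomposition assms(3,4,5)] noncong by blast
  qed
  moreover have "M div q ^ multiplicity q M = N"
    using decomposition(1) prime_gt_0_nat[OF assms(2)]
    by (metis nonzero_mult_div_cancel_left power_not_zero gr_implies_not0)
  ultimately show ?thesis by (auto simp: decomposition_group_def)
qed

section \<open>Fourier sums of roots of unity\<close>

definition fourier :: "nat \<Rightarrow> (nat \<Rightarrow> complex) \<Rightarrow> complex" where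
  "fourier N b = (\<Sum>v<N. b v * zeta N ^ v)"

lemma norm_fourier_le:
  assumes "\<And>v. norm (b v) = 1"
  shows "norm (fourier N b) \<le> real N"
  unfolding fourier_def using norm_sum[of "\<lambda>v. b v * zeta N ^ v" "{..<N}"]
  by (simp add: norm_mult norm_power assms)

lemma sum_residue_class:
  fixes f :: "nat \<Rightarrow> 'a::comm_monoid_add"
  assumes "p dvd N" "y < p"
  shows "(\<Sum>v | v < N \<and> v mod p = y. f v) = (\<Sum>v<N div p. f (y + p * v))"
proof (rule sum.reindex_bij_witness[of _ "\<lambda>v. y + p * v" "\<lambda>v. v div p"])
  obtain r where N_eq: "N = p * r" using assms(1) by (elim dvdE)
  have "p > 0" using assms(2) by simp
  fix v assume "v \<in> {..<N div p}"
  then have "v < r" using \<open>p > 0\<close> by (simp add: N_eq)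
  show "(y + p * v) div p = v" using assms(2) by simp
  have "y + p * v < p * Suc v" using assms(2) by simp
  also have "\<dots> \<le> N" unfolding N_eq using \<open>v < r\<close> by (intro mult_le_mono2) simp
  finally show "y + p * v \<in> {v. v < N \<and> v mod p = y}" using assms(2) by simp
next
  obtain r where N_eq: "N = p * r" using assms(1) by (elim dvdE)
  fix v assume v_class: "v \<in> {v. v < N \<and> v mod p = y}"
  then show "y + p * (v div p) = v" by auto
  then show "f (y + p * (v div p)) = f v" by simp
  show "v div p \<in> {..<N div p}"
    using v_class assms(2) by (simp add: N_eq less_mult_imp_div_less mult.commute)
qed

lemma fourier_residue_class:
  assumes "p dvd N" "y < p"
  shows "(\<Sum>v | v < N \<and> v mod p = y. b v * zeta N ^ v)
    = zeta N ^ y * fourier (N div p) (\<lambda>v. b (y + p * v))"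
proof -
  have "zeta N ^ p = zeta (N div p)"
    using zeta_mult_power[of p "N div p"] assms by simp
  then have "zeta N ^ (y + p * v) = zeta N ^ y * zeta (N div p) ^ v" for v
    by (simp add: power_add power_mult)
  then show ?thesis
    unfolding sum_residue_class[OF assms] fourier_def sum_distrib_left by (simp add: mult_ac)
qed

lemma twisted_root_of_unity_cases:
  fixes eps rho :: "'a::idom"
  assumes "prime p" "eps ^ p * rho ^ (\<Sum>i<p. i) = 1" "rho ^ p = 1"
  obtains "eps ^ p = 1" | "p = 2" "rho = -1" "eps\<^sup>2 = -1"
proof (cases "p = 2")
  case True
  have "eps\<^sup>2 * rho = 1" using assms(2) by (simp add: True numeral_2_eq_2)
  have "rho = 1 \<or> rho = -1" using assms(3) by (simp add: True power2_eq_1_iff)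
  then show ?thesis
  proof
    assume "rho = 1"
    then show ?thesis using \<open>eps\<^sup>2 * rho = 1\<close> that(1) by (simp add: True)
  next
    assume "rho = -1"
    then have "eps\<^sup>2 = -1" using \<open>eps\<^sup>2 * rho = 1\<close> by (simp add: minus_equation_iff[of "eps\<^sup>2"])
    then show ?thesis using True \<open>rho = -1\<close> that(2) by blast
  qed
next
  case False
  then have "odd p" using primes_dvd_imp_eq[OF two_is_prime_nat assms(1)] by blast
  then obtain r where p_eq: "p = 2 * r + 1" by (elim oddE)
  have "(\<Sum>i<p. i) = p * r" using Sum_Ico_nat[of 0 p] by (simp add: p_eq lessThan_atLeast0)
  then have "eps ^ p = 1" using assms(2,3) by (simp add: power_mult)
  then show ?thesis by (rule that(1))
qed

text \<open>Sums \<open>fourier N b\<close> inside the \<open>M\<close>th cyclotomic ring, together with the automorphism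
  \<open>\<zeta> \<mapsto> \<zeta>\<^sup>1\<^sup>+\<^sup>M\<^sup>/\<^sup>p\<close>, which fixes the coefficients and has order \<open>p\<close>.\<close>

locale cyclotomic_fourier_sum =
  fixes M N p h :: nat and b :: "nat \<Rightarrow> complex"
  assumes M_pos: "M > 0" and prime: "prime p"
    and N_dvd: "N dvd M" and coprime_cofactor: "coprime p (M div N)"
    and h_mult_dvd: "h * p dvd M"
    and radical: "\<And>l. prime l \<Longrightarrow> l dvd M \<Longrightarrow> l dvd h"
    and coeff_root: "\<And>v. b v ^ h = 1"
begin

lemma p_pos: "p > 0"
  using prime by (rule prime_gt_0_nat)

lemma p_dvd: "p dvd M" "p dvd h"
proof -
  show "p dvd M" using h_mult_dvd by (rule dvd_mult_right)
  then show "p dvd h" using radical prime by blast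
qed

lemma h_dvd: "h dvd M" "h dvd M div p"
  using h_mult_dvd p_pos by (auto intro: dvd_mult_left dvd_mult_imp_div)

sublocale cyclotomic_automorphism M "zeta M" "Suc (M div p)"
proof
  show "prim_root M (zeta M)" using M_pos by (rule prim_root_zeta)
  show "coprime (Suc (M div p)) M"
    using radical h_dvd(2) coprime_one_plus_cofactor[of M p] by (auto intro: dvd_trans)
qed

abbreviation sigma :: "complex \<Rightarrow> complex" where
  "sigma \<equiv> galois (zeta M) (Suc (M div p))"

text \<open>The factor by which \<open>sigma\<close> multiplies \<open>zeta N\<close>.\<close>

definition theta :: complex where
  "theta = zeta N ^ (M div p)"

lemma sigma_fixes:
  assumes "x ^ h = 1"
  shows "x \<in> int_adjoin (zeta M)" "sigma x = x"
proof -
  have "x ^ M = 1" using h_dvd(1) assms by (metis dvdE power_mult power_one)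
  then show "x \<in> int_adjoin (zeta M)" by (rule root_of_unity_in_int_adjoin)
  have "x ^ (M div p) = 1" using h_dvd(2) assms by (metis dvdE power_mult power_one)
  then show "sigma x = x" using galois_root_of_unity[OF \<open>x ^ M = 1\<close>] by simp
qed

lemma zeta_N: "zeta N = zeta M ^ (M div N)"
  using zeta_mult_power[of "M div N" N] N_dvd M_pos by (auto elim!: dvdE)

lemma zeta_N_in_int_adjoin [simp]: "zeta N \<in> int_adjoin (zeta M)"
  by (simp add: zeta_N)

lemma prim_root_theta: "prim_root p theta"
proof -
  have "prim_root p (zeta M ^ (M div p))"
    using prim_root p_dvd(1) by (intro prim_root_power_dvd) simp
  then have "prim_root p ((zeta M ^ (M div p)) ^ (M div N))"
    using coprime_cofactor by (rule prim_root_power_coprime[OF _ coprime_commute[THEN iffD1]])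
  also have "(zeta M ^ (M div p)) ^ (M div N) = theta"
    by (simp only: theta_def zeta_N mult.commute flip: power_mult)
  finally show ?thesis .
qed

lemma theta_power_p: "theta ^ p = 1"
  using prim_root_theta by (rule prim_rootD)

lemma sigma_fixes_if_power_p:
  assumes "x ^ p = 1"
  shows "x \<in> int_adjoin (zeta M)" "sigma x = x"
  using sigma_fixes[of x] p_dvd(2) assms by (metis dvdE power_mult power_one)+

lemma funpow_sigma_fourier:
  "(sigma ^^ j) (fourier N b) = (\<Sum>v<N. b v * zeta N ^ v * theta ^ (j * v))"
proof (induction j)
  case (Suc j)
  have "sigma (zeta N) = (zeta M ^ Suc (M div p)) ^ (M div N)"
    by (simp add: zeta_N galois_generator del: power_Suc)
  also have "\<dots> = (zeta M ^ (M div N)) ^ Suc (M div p)"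
    by (simp only: mult.commute flip: power_mult)
  finally have "sigma (zeta N) = zeta N * theta" by (simp add: theta_def zeta_N)
  then have "sigma (b v * zeta N ^ v * theta ^ (j * v)) = b v * zeta N ^ v * theta ^ (Suc j * v)" for v
    using sigma_fixes[OF coeff_root] sigma_fixes_if_power_p[OF theta_power_p]
    by (simp add: power_mult_distrib power_add)
  then show ?case
    using Suc sigma_fixes(1)[OF coeff_root] sigma_fixes_if_power_p(1)[OF theta_power_p]
    by (simp add: galois_sum)
qed (simp add: fourier_def)

lemma fourier_in_int_adjoin [simp]: "fourier N b \<in> int_adjoin (zeta M)"
  using sigma_fixes(1)[OF coeff_root] by (simp add: fourier_def)

lemma funpow_sigma_twisted_eigenvector:
  assumes "x \<in> int_adjoin (zeta M)" "eps \<in> int_adjoin (zeta M)" "rho \<in> int_adjoin (zeta M)"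
    and "sigma x = eps * x" "sigma eps = rho * eps" "sigma rho = rho"
  shows "(sigma ^^ j) x = eps ^ j * rho ^ (\<Sum>i<j. i) * x"
proof (induction j)
  case (Suc j)
  then show ?case using assms by (simp add: power_mult_distrib power_add mult_ac)
qed simp

lemma eigenvector_residue_class:
  assumes "sigma (fourier N b) = eps * fourier N b" "eps ^ p = 1"
  obtains y where "y < p" "fourier N b = zeta N ^ y * fourier (N div p) (\<lambda>v. b (y + p * v))"
proof -
  obtain y where eps_eq: "eps = theta ^ y" "y < p"
    using root_of_unity_eq_power[OF prim_root_theta assms(2)] by blast
  have orbit: "(sigma ^^ j) (fourier N b) = theta ^ (y * j) * fourier N b" for j
    using funpow_sigma_twisted_eigenvector[of "fourier N b" eps 1 j] assms
      sigma_fixes_if_power_p[OF assms(2)]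
    by (simp add: eps_eq(1) power_mult)
  have "theta ^ (j * (p - y)) * theta ^ (y * j) = 1" for j
  proof -
    have "j * (p - y) + y * j = p * j"
      using eps_eq(2) by (simp add: algebra_simps diff_mult_distrib2)
    then have "theta ^ (j * (p - y)) * theta ^ (y * j) = (theta ^ p) ^ j"
      by (simp only: flip: power_add power_mult)
    then show ?thesis by (simp add: theta_power_p)
  qed
  then have "of_nat p * fourier N b = (\<Sum>j<p. theta ^ (j * (p - y)) * (sigma ^^ j) (fourier N b))"
    by (simp add: orbit flip: mult.assoc)
  also have "\<dots> = of_nat p * (\<Sum>v | v \<in> {..<N} \<and> v mod p = y. b v * zeta N ^ v)"
    unfolding funpow_sigma_fourier
    by (rule prim_root_fourier_inversion[OF prim_root_theta eps_eq(2)]) simp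
  finally have "fourier N b = (\<Sum>v | v < N \<and> v mod p = y. b v * zeta N ^ v)"
    using p_pos by simp
  also have "p dvd N"
    using p_dvd(1) N_dvd coprime_cofactor
    by (metis coprime_dvd_mult_left_iff dvd_mult_div_cancel)
  then have "(\<Sum>v | v < N \<and> v mod p = y. b v * zeta N ^ v)
      = zeta N ^ y * fourier (N div p) (\<lambda>v. b (y + p * v))"
    using eps_eq(2) by (rule fourier_residue_class)
  finally show ?thesis using that eps_eq(2) by blast
qed

lemma power_mult_cofactor_power: "(zeta M ^ (k * (M div p))) ^ p = 1"
proof -
  have "(zeta M ^ (k * (M div p))) ^ p = zeta M ^ (k * (M div p * p))"
    by (simp only: mult.assoc flip: power_mult)
  also have "\<dots> = 1" using p_dvd(1) by (simp add: prim_rootD(3)[OF prim_root])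
  finally show ?thesis .
qed

lemma eigenvalue_power_p:
  assumes "sigma (fourier N b) = of_int s * zeta M ^ k * fourier N b" "fourier N b \<noteq> 0"
  shows "(of_int s * zeta M ^ k) ^ p * (zeta M ^ (k * (M div p))) ^ (\<Sum>i<p. i) = 1"
    (is "?eps ^ p * ?rho ^ _ = 1")
proof -
  have "?rho ^ p = 1" by (rule power_mult_cofactor_power)
  moreover have "sigma ?eps = ?rho * ?eps"
    by (simp add: galois_generator power_mult_distrib mult_ac flip: power_mult power_add)
  ultimately have "(sigma ^^ p) (fourier N b) = ?eps ^ p * ?rho ^ (\<Sum>i<p. i) * fourier N b"
    using sigma_fixes_if_power_p assms(1)
    by (intro funpow_sigma_twisted_eigenvector) auto
  moreover have "(sigma ^^ p) (fourier N b) = fourier N b"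
    unfolding funpow_sigma_fourier power_mult theta_power_p by (simp add: fourier_def)
  ultimately show ?thesis using assms(2) by simp
qed

lemma eigenvalue_cases:
  assumes "sigma (fourier N b) = of_int s * zeta M ^ k * fourier N b" "fourier N b \<noteq> 0"
    and "s = 1 \<or> odd M \<and> s = -1"
  shows "(of_int s * zeta M ^ k :: complex) ^ p = 1
    \<or> p = 2 \<and> \<not> 8 dvd M \<and> (of_int s * zeta M ^ k :: complex)\<^sup>2 = -1"
proof -
  define eps rho where "eps = of_int s * zeta M ^ k" and "rho = zeta M ^ (k * (M div p))"
  have "eps ^ p * rho ^ (\<Sum>i<p. i) = 1"
    unfolding eps_def rho_def by (rule eigenvalue_power_p[OF assms(1,2)])
  moreover have "rho ^ p = 1" unfolding rho_def by (rule power_mult_cofactor_power)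
  ultimately consider (root) "eps ^ p = 1" | (twisted) "p = 2" "rho = -1" "eps\<^sup>2 = -1"
    by (rule twisted_root_of_unity_cases[OF prime])
  then have "eps ^ p = 1 \<or> p = 2 \<and> \<not> 8 dvd M \<and> eps\<^sup>2 = -1"
  proof cases
    case twisted
    have "\<not> 8 dvd M"
    proof
      assume "8 dvd M"
      then obtain r where "M = 8 * r" by (elim dvdE)
      moreover have "eps = zeta M ^ k" using assms(3) p_dvd(1) \<open>p = 2\<close> by (auto simp: eps_def)
      ultimately have "rho = (eps\<^sup>2) ^ (2 * r)"
        by (simp add: rho_def \<open>p = 2\<close> mult.assoc flip: power_mult)
      then show False using twisted by simp
    qed
    then show ?thesis using twisted by blast
  qed blast
  then show ?thesis by (simp add: eps_def)
qed

lemma descent: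
  assumes "n > 0" "(norm (fourier N b))\<^sup>2 = of_nat n"
    and "\<And>q. prime q \<Longrightarrow> q dvd n \<Longrightarrow> q dvd M \<and> Suc (M div p) \<in> decomposition_group q M"
  obtains (residue_class) y
    where "norm (fourier (N div p) (\<lambda>v. b (y + p * v))) = norm (fourier N b)"
  | (exceptional) eps where "p = 2" "\<not> 8 dvd M" "eps\<^sup>2 = -1"
      "fourier N (\<lambda>v. b v * (-1) ^ v) = eps * fourier N b"
proof -
  obtain s :: int and k where eigenvector: "s = 1 \<or> odd M \<and> s = -1"
      "sigma (fourier N b) = of_int s * zeta M ^ k * fourier N b"
    using galois_eq_signed_power_mult[OF prim_root assms(1) coprime_exponent assms(3) _ assms(2)]
    by auto
  have "fourier N b \<noteq> 0" using assms(1,2) by auto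
  then consider (root) "(of_int s * zeta M ^ k :: complex) ^ p = 1"
    | (twisted) "p = 2" "\<not> 8 dvd M" "(of_int s * zeta M ^ k :: complex)\<^sup>2 = -1"
    using eigenvalue_cases[OF eigenvector(2) _ eigenvector(1)] by blast
  then show ?thesis
  proof cases
    case root
    then obtain y where "fourier N b = zeta N ^ y * fourier (N div p) (\<lambda>v. b (y + p * v))"
      using eigenvector_residue_class[OF eigenvector(2)] by blast
    then have "norm (fourier N b) = norm (fourier (N div p) (\<lambda>v. b (y + p * v)))"
      by (simp add: norm_mult norm_power)
    then show ?thesis using residue_class by simp
  next
    case twisted
    have "theta = -1" using prim_root_half[of 1 theta] prim_root_theta twisted(1) by simp
    then have "fourier N (\<lambda>v. b v * (-1) ^ v) = sigma (fourier N b)"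
      using funpow_sigma_fourier[of 1] by (simp add: fourier_def mult_ac)
    then show ?thesis using exceptional twisted eigenvector(2) by simp
  qed
qed

end

section \<open>Perfect sequences of roots of unity\<close>

lemma sum_shift_mod:
  fixes f :: "nat \<Rightarrow> 'a::comm_monoid_add"
  assumes "n > 0"
  shows "(\<Sum>u<n. f ((x + u) mod n)) = (\<Sum>u<n. f u)"
proof (rule sum.reindex_bij_betw)
  show "bij_betw (\<lambda>u. (x + u) mod n) {..<n} {..<n}"
    unfolding bij_betw_def
  proof
    show inj: "inj_on (\<lambda>u. (x + u) mod n) {..<n}"
    proof (rule inj_onI)
      fix u v assume collision: "u \<in> {..<n}" "v \<in> {..<n}" "(x + u) mod n = (x + v) mod n"
      then have "[x + u = x + v] (mod n)" by (simp add: cong_def)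
      then have "[u = v] (mod n)" by (simp only: cong_add_lcancel_nat)
      then show "u = v" using collision by (simp add: cong_def)
    qed
    show "(\<lambda>u. (x + u) mod n) ` {..<n} = {..<n}"
      using assms inj by (intro endo_inj_surj) auto
  qed
qed

locale bh_sequence =
  fixes n h :: nat and c :: "nat \<Rightarrow> complex"
  assumes n_pos: "n > 0" and h_pos: "h > 0"
    and root: "\<And>u. c u ^ h = 1"
    and periodic: "\<And>u. c (u mod n) = c u"
    and autocorrelation: "\<And>d. \<not> n dvd d \<Longrightarrow> (\<Sum>u<n. c (u + d) * cnj (c u)) = 0"
begin

lemma norm_c [simp]: "norm (c u) = 1"
  using root h_pos by (rule norm_root_of_unity)

lemma shifted_autocorrelation:
  assumes "\<not> n dvd d"
  shows "(\<Sum>u<n. c (x + u + d) * cnj (c (x + u))) = 0"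
proof -
  have "(\<Sum>u<n. c (x + u + d) * cnj (c (x + u)))
      = (\<Sum>u<n. c ((x + u) mod n + d) * cnj (c ((x + u) mod n)))"
    using periodic by (metis mod_add_left_eq)
  also have "\<dots> = (\<Sum>u<n. c (u + d) * cnj (c u))"
    using n_pos by (rule sum_shift_mod[where f = "\<lambda>u. c (u + d) * cnj (c u)"])
  finally show ?thesis using autocorrelation assms by simp
qed

lemma norm_fourier: "(norm (fourier n c))\<^sup>2 = of_nat n"
proof -
  note zeta = prim_root_zeta[OF n_pos]
  define z where "z = zeta n"
  have z_cnj: "z ^ v * cnj (z ^ v) = 1" for v
    unfolding complex_norm_square[symmetric] by (simp add: z_def norm_power)
  have summand: "c ((v + d) mod n) * z ^ ((v + d) mod n) * cnj (c v * z ^ v)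
      = c (v + d) * cnj (c v) * z ^ d" for v d
  proof -
    have "c ((v + d) mod n) * z ^ ((v + d) mod n) * cnj (c v * z ^ v)
        = c (v + d) * cnj (c v) * z ^ d * (z ^ v * cnj (z ^ v))"
      unfolding periodic z_def prim_root_power_mod[OF zeta] by (simp add: power_add mult_ac)
    then show ?thesis by (simp only: z_cnj mult_1_right)
  qed
  have "fourier n c * cnj (fourier n c) = (\<Sum>v<n. (\<Sum>u<n. c u * z ^ u) * cnj (c v * z ^ v))"
    unfolding fourier_def z_def cnj_sum sum_distrib_left ..
  also have "\<dots> = (\<Sum>v<n. \<Sum>d<n. c (v + d) * cnj (c v) * z ^ d)"
  proof (intro sum.cong refl)
    fix v
    have "(\<Sum>u<n. c u * z ^ u) = (\<Sum>d<n. c ((v + d) mod n) * z ^ ((v + d) mod n))"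
      by (rule sum_shift_mod[OF n_pos, symmetric])
    then show "(\<Sum>u<n. c u * z ^ u) * cnj (c v * z ^ v) = (\<Sum>d<n. c (v + d) * cnj (c v) * z ^ d)"
      by (simp only: sum_distrib_right summand)
  qed
  also have "\<dots> = (\<Sum>d<n. (\<Sum>v<n. c (v + d) * cnj (c v)) * z ^ d)"
    by (subst sum.swap) (simp add: sum_distrib_right)
  also have "\<dots> = (\<Sum>d<n. if d = 0 then of_nat n else 0)"
  proof (intro sum.cong refl)
    fix d assume "d \<in> {..<n}"
    have "c v * cnj (c v) = 1" for v by (simp flip: complex_norm_square)
    then show "(\<Sum>v<n. c (v + d) * cnj (c v)) * z ^ d = (if d = 0 then of_nat n else 0)"
      using autocorrelation[of d] \<open>d \<in> {..<n}\<close> by (auto simp: nat_dvd_not_less)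
  qed
  also have "\<dots> = of_nat n" using n_pos by simp
  finally show ?thesis by (simp only: norm_power2_eq_of_nat_iff)
qed

text \<open>By Parseval's identity, the residue class of \<open>x\<close> modulo \<open>k\<close> then carries the whole sum
  \<open>fourier n c\<close>.\<close>

definition concentrated :: "nat \<Rightarrow> bool" where
  "concentrated k \<longleftrightarrow> (\<exists>x. (norm (fourier (n div k) (\<lambda>v. c (x + k * v))))\<^sup>2 = of_nat n)"

lemma concentrated_1: "concentrated 1"
  unfolding concentrated_def using norm_fourier by (intro exI[of _ 0]) simp

lemma concentrated_imp_le_square:
  assumes "concentrated k"
  shows "n \<le> (n div k)\<^sup>2"
proof -
  obtain x where norm_square: "(norm (fourier (n div k) (\<lambda>v. c (x + k * v))))\<^sup>2 = of_nat n"
    using assms by (auto simp: concentrated_def)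
  have "(norm (fourier (n div k) (\<lambda>v. c (x + k * v))))\<^sup>2 \<le> (real (n div k))\<^sup>2"
    by (intro power_mono norm_fourier_le) simp_all
  then have "real n \<le> real ((n div k)\<^sup>2)" by (simp add: norm_square)
  then show ?thesis by (simp only: of_nat_le_iff)
qed

end

lemma cmod_eq_1_Re_eq_1:
  assumes "norm z = 1" "Re z = 1"
  shows "z = 1"
  using assms cmod_power2[of z] by (simp add: complex_eq_iff)

lemma cmod_eq_1_Re_eq_0:
  assumes "norm z = 1" "Re z = 0"
  shows "z\<^sup>2 = -1"
  using assms cmod_power2[of z] by (simp add: complex_eq_iff power2_eq_square)

context bh_sequence
begin

lemma bh_sequence_shift: "bh_sequence n h (\<lambda>u. c (x + u))"
proof
  show "c (x + u mod n) = c (x + u)" for u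
    using periodic by (metis mod_add_right_eq)
  show "(\<Sum>u<n. c (x + (u + d)) * cnj (c (x + u))) = 0" if "\<not> n dvd d" for d
    using shifted_autocorrelation[OF that] by (simp add: add.assoc)
qed (rule n_pos h_pos root)+

lemma autocorrelation_order_8:
  assumes "n = 8" "\<not> 8 dvd d"
  shows "c d * cnj (c 0) + c (1 + d) * cnj (c 1) + c (2 + d) * cnj (c 2) + c (3 + d) * cnj (c 3)
    + c (4 + d) * cnj (c 4) + c (5 + d) * cnj (c 5) + c (6 + d) * cnj (c 6) + c (7 + d) * cnj (c 7) = 0"
  using autocorrelation[of d] assms by (simp add: eval_nat_numeral)

lemma periodic_order_8:
  assumes "n = 8"
  shows "c 8 = c 0" "c 9 = c 1" "c 10 = c 2" "c 11 = c 3"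
  using periodic[of 8] periodic[of 9] periodic[of 10] periodic[of 11] assms by simp_all

text \<open>The order 8 survives the norm estimate in the exceptional case of the descent; the
  autocorrelations at the shifts 4 and 2 exclude it.\<close>

lemma odd_terms_of_alternating_order_8:
  assumes "n = 8" "c 4 = - c 0" "c 6 = - c 2"
  shows "c 5 = c 1" "c 7 = c 3"
proof -
  define alpha beta where "alpha = c 5 * cnj (c 1)" and "beta = c 7 * cnj (c 3)"
  have "norm alpha = 1" "norm beta = 1" by (simp_all add: alpha_def beta_def norm_mult)
  have "Re alpha + Re beta = 2"
  proof -
    have "c u * cnj (c u) = 1" for u by (simp flip: complex_norm_square)
    then have "alpha + cnj alpha + (beta + cnj beta) = 4"
      using autocorrelation_order_8[OF assms(1), of 4]
      by (simp add: periodic_order_8[OF assms(1)] assms(2,3) alpha_def beta_def algebra_simps)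
    from arg_cong[OF this, of Re] show ?thesis by simp
  qed
  moreover have "Re alpha \<le> 1" "Re beta \<le> 1"
    using complex_Re_le_cmod[of alpha] complex_Re_le_cmod[of beta]
    by (simp_all add: \<open>norm alpha = 1\<close> \<open>norm beta = 1\<close>)
  ultimately have "Re alpha = 1" "Re beta = 1" by linarith+
  then have "alpha = 1" "beta = 1"
    using cmod_eq_1_Re_eq_1 \<open>norm alpha = 1\<close> \<open>norm beta = 1\<close> by blast+
  moreover have "c u = c v" if "c u * cnj (c v) = 1" for u v
  proof -
    have "c v * cnj (c v) = 1" by (simp flip: complex_norm_square)
    then show ?thesis using that by (metis mult_cancel_right mult_zero_right zero_neq_one)
  qed
  ultimately show "c 5 = c 1" "c 7 = c 3" by (simp_all add: alpha_def beta_def)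
qed

lemma no_alternating_sequence_of_order_8:
  assumes "n = 8" "even h" "\<not> 4 dvd h" "c 4 = - c 0" "c 6 = - c 2"
  shows False
proof -
  note odd_terms = odd_terms_of_alternating_order_8[OF assms(1,4,5)]
  define rho where "rho = c 3 * cnj (c 1)"
  have "2 * (c 2 * cnj (c 0) - cnj (c 2 * cnj (c 0))) + 2 * (rho + cnj rho) = 0"
    using autocorrelation_order_8[OF assms(1), of 2]
    by (simp add: periodic_order_8[OF assms(1)] assms(4,5) odd_terms rho_def algebra_simps
        flip: numeral_2_eq_2 numeral_3_eq_3)
  from arg_cong[OF this, of Re] have "Re rho = 0" by simp
  moreover have "norm rho = 1" by (simp add: rho_def norm_mult)
  ultimately have "rho\<^sup>2 = -1" by (intro cmod_eq_1_Re_eq_0)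
  obtain h' where "h = 2 * h'" using assms(2) by (elim evenE)
  then have "odd h'" using assms(3) by auto
  then have "rho ^ h = -1" by (simp add: \<open>h = 2 * h'\<close> power_mult \<open>rho\<^sup>2 = -1\<close>)
  moreover have "rho ^ h = 1"
    by (simp add: rho_def root power_mult_distrib flip: complex_cnj_power)
  ultimately show False by simp
qed

end

lemma cmod_parallelogram_law:
  "(norm (x - y))\<^sup>2 + (norm (x + y))\<^sup>2 = 2 * (norm x)\<^sup>2 + 2 * (norm (y :: complex))\<^sup>2"
  unfolding cmod_power2 by (simp add: power2_eq_square algebra_simps)

lemma fourier_4_alternating:
  assumes norm_b: "\<And>v. norm (b v) = 1" and "eps\<^sup>2 = -1"
    and eigenvector: "fourier 4 (\<lambda>v. b v * (-1) ^ v) = eps * fourier 4 b"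
    and norm_square: "(norm (fourier 4 b))\<^sup>2 = real n"
  shows "n \<le> 8" "n = 8 \<Longrightarrow> b 2 = - b 0 \<and> b 3 = - b 1"
proof -
  \<comment> \<open>the even and the odd part of the sum, which turn out to have equal norms\<close>
  define E D where "E = b 0 - b 2" and "D = b 1 - b 3"
  have "zeta 4 = \<i>" by (simp add: zeta_def)
  moreover have "(\<Sum>v<4. f v) = f 0 + f 1 + f 2 + f 3" for f :: "nat \<Rightarrow> complex"
    by (simp add: eval_nat_numeral)
  ultimately have parts: "fourier 4 b = E + \<i> * D" "eps * fourier 4 b = E - \<i> * D"
    unfolding eigenvector[symmetric] unfolding fourier_def
    by (simp_all add: E_def D_def power3_eq_cube algebra_simps)
  have "2 * E = (1 + eps) * fourier 4 b" "2 * (\<i> * D) = (1 - eps) * fourier 4 b"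
    unfolding distrib_right left_diff_distrib mult_1_left parts(2) unfolding parts(1) by simp_all
  then have "(norm (2 * E))\<^sup>2 = (norm (1 + eps))\<^sup>2 * n"
      "(norm (2 * (\<i> * D)))\<^sup>2 = (norm (1 - eps))\<^sup>2 * n"
    by (simp_all only: norm_mult power_mult_distrib norm_square)
  moreover have "eps = \<i> \<or> eps = - \<i>" using assms(2) by (simp flip: power2_eq_iff)
  then have "(norm (1 + eps))\<^sup>2 = 2" "(norm (1 - eps))\<^sup>2 = 2" by (auto simp: cmod_power2)
  ultimately have norm_parts: "2 * (norm E)\<^sup>2 = n" "2 * (norm D)\<^sup>2 = n"
    by (simp_all add: norm_mult power_mult_distrib)
  have parallelogram: "(norm (b u - b v))\<^sup>2 + (norm (b u + b v))\<^sup>2 = 4" for u v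
    by (simp add: cmod_parallelogram_law norm_b)
  have "real n \<le> 8"
    using parallelogram[of 0 2] norm_parts(1) zero_le_power2[of "norm (b 0 + b 2)"]
    unfolding E_def by linarith
  then show "n \<le> 8" by simp
  assume "n = 8"
  then have "(norm (b 0 + b 2))\<^sup>2 = 0" "(norm (b 1 + b 3))\<^sup>2 = 0"
    using parallelogram[of 0 2] parallelogram[of 1 3] norm_parts by (simp_all add: E_def D_def)
  then show "b 2 = - b 0 \<and> b 3 = - b 1" by (simp add: add_eq_0_iff)
qed

lemma unique_prime_divisor_imp_power:
  fixes n p :: nat
  assumes "n > 0" "prime p" "\<And>q. prime q \<Longrightarrow> q dvd n \<Longrightarrow> q = p"
  obtains e where "n = p ^ e"
proof -
  obtain N where decomposition: "n = p ^ multiplicity p n * N" "\<not> p dvd N"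
    using multiplicity_decompose'[of n p] assms(1,2) by (metis not_prime_unit gr_implies_not0)
  have "N = 1"
  proof (rule ccontr)
    assume "N \<noteq> 1"
    then obtain q where "prime q" "q dvd N" using prime_factor_nat by blast
    moreover have "N dvd n" using decomposition(1) by (metis dvd_triv_right)
    ultimately show False using assms(3) decomposition(2) dvd_trans by blast
  qed
  then show ?thesis using that decomposition(1) by simp
qed

lemma gcd_two_power_eq_2:
  fixes h n :: nat
  assumes "n = 2 ^ e" "even h" "\<not> 4 dvd h" "even n"
  shows "gcd h n = 2"
proof -
  obtain i where gcd_eq: "gcd h n = 2 ^ i"
    using assms(1) by (metis divides_primepow_nat gcd_dvd2 two_is_prime_nat)
  have "i \<noteq> 0" using assms(2,4) gcd_eq by (metis gcd_greatest odd_one power_0)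
  moreover have "\<not> 2 \<le> i"
  proof
    assume "2 \<le> i"
    then have "(2 :: nat) ^ 2 dvd gcd h n" unfolding gcd_eq by (rule le_imp_power_dvd)
    then show False using assms(3) by simp
  qed
  ultimately have "i = 1" by simp
  then show ?thesis by (simp add: gcd_eq)
qed

locale bh_sequence_field_descent = bh_sequence +
  assumes prime_dvd_h: "\<And>p. prime p \<Longrightarrow> p dvd n \<Longrightarrow> p dvd h"
    and noncong: "\<And>p q. prime p \<Longrightarrow> p dvd n \<Longrightarrow> prime q \<Longrightarrow> q dvd n \<Longrightarrow> q \<noteq> p \<Longrightarrow>
        \<not> [q ^ ord (mtilde (lcm n h) q) q = 1] (mod p ^ (multiplicity p h + 1))"
begin

lemma prime_dvd_lcm_imp_dvd_h: "prime l \<Longrightarrow> l dvd lcm n h \<Longrightarrow> l dvd h"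
  using prime_dvd_h by (meson dvd_triv_left dvd_triv_right dvd_trans lcm_least prime_dvd_multD)

lemma exceptional_parameters:
  assumes "n = gcd h n * (2 * k * s)" "\<not> 8 dvd h * (2 * s)" "even h"
  shows "gcd h n = 2" "n = 4 * k" "\<not> 4 dvd h"
proof -
  show not_4_dvd: "\<not> 4 dvd h"
  proof
    assume "4 dvd h"
    then have "4 * 2 dvd h * (2 * s)" by (intro mult_dvd_mono) auto
    then show False using assms(2) by simp
  qed
  have "odd s"
  proof
    assume "even s"
    then have "2 * (2 * 2) dvd h * (2 * s)" using assms(3) by (intro mult_dvd_mono) auto
    then show False using assms(2) by simp
  qed
  have "even n" using assms(1) by (metis dvd_mult dvd_mult2 dvd_triv_left)
  have "multiplicity 2 h = 1"
    using assms(3) not_4_dvd by (intro multiplicity_eqI) auto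
  have "q = 2" if prime_q: "prime q" "q dvd n" for q
  proof (rule ccontr)
    assume "q \<noteq> 2"
    have "[q ^ ord (mtilde (lcm n h) q) q = 1] (mod 4)"
      using \<open>even n\<close> \<open>q \<noteq> 2\<close> by (intro cong_1_mtilde_imp_cong_1_4[OF ord]) auto
    then show False
      using noncong[OF two_is_prime_nat \<open>even n\<close> prime_q \<open>q \<noteq> 2\<close>] \<open>multiplicity 2 h = 1\<close> by simp
  qed
  then obtain e where n_eq: "n = 2 ^ e"
    using unique_prime_divisor_imp_power[OF n_pos two_is_prime_nat] by blast
  then show gcd: "gcd h n = 2" using assms(3) not_4_dvd \<open>even n\<close> by (rule gcd_two_power_eq_2)
  have "s dvd 2 ^ e" using assms(1) unfolding n_eq by (metis dvd_triv_right mult.assoc)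
  moreover have "coprime s (2 ^ e)" using \<open>odd s\<close> by simp
  ultimately have "s = 1" using coprime_common_divisor[of s "2 ^ e" s] by simp
  then show "n = 4 * k" using assms(1) gcd by simp
qed

lemma exceptional_le_gcd_square:
  assumes "n = gcd h n * (2 * k * s)" "\<not> 8 dvd h * (2 * s)" "even h"
    and "(norm (fourier (n div k) (\<lambda>v. c (x + k * v))))\<^sup>2 = of_nat n" "eps\<^sup>2 = -1"
    and "fourier (n div k) (\<lambda>v. c (x + k * v) * (-1) ^ v) = eps * fourier (n div k) (\<lambda>v. c (x + k * v))"
  shows "n \<le> (gcd h n)\<^sup>2"
proof -
  note parameters = exceptional_parameters[OF assms(1-3)]
  have "k > 0" using parameters(2) n_pos by simp
  then have "n div k = 4" using parameters(2) by simp
  note bound = fourier_4_alternating[of "\<lambda>v. c (x + k * v)" eps n]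
  have "n \<le> 8" using bound(1) assms(4-6) \<open>n div k = 4\<close> by simp
  have "k \<noteq> 2"
  proof
    assume "k = 2"
    then have "n = 8" using parameters(2) by simp
    then have "c (x + 4) = - c (x + 0)" "c (x + 6) = - c (x + 2)"
      using bound(2) assms(4-6) \<open>n div k = 4\<close> \<open>k = 2\<close> by simp_all
    then show False
      using bh_sequence.no_alternating_sequence_of_order_8[OF bh_sequence_shift \<open>n = 8\<close> assms(3)
          parameters(3)] by blast
  qed
  then have "k = 1" using \<open>n \<le> 8\<close> \<open>k > 0\<close> parameters(2) by simp
  then show ?thesis using parameters by simp
qed

lemma lcm_eq_div_gcd:
  assumes "n div gcd h n = r"
  shows "lcm n h = h * r" "n = gcd h n * r" "coprime (h div gcd h n) r"
proof -
  show "n = gcd h n * r" using assms by (simp flip: assms)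
  have "lcm n h * gcd h n = h * (gcd h n * r)"
    using prod_gcd_lcm_nat[of h n] \<open>n = gcd h n * r\<close> by (simp add: lcm.commute mult.commute)
  then show "lcm n h = h * r" using n_pos by simp
  show "coprime (h div gcd h n) r" unfolding assms[symmetric]
    using n_pos by (intro div_gcd_coprime) auto
qed

context
  fixes p k s M :: nat
  assumes prime_p: "prime p" and quotient: "n div gcd h n = p * k * s" and M_def: "M = h * (p * s)"
begin

lemma factors_pos: "k > 0" "s > 0"
  using lcm_eq_div_gcd(2)[OF quotient] n_pos by (auto intro!: gr0I)

lemma lcm_eq_mult: "lcm n h = M * k"
  using lcm_eq_div_gcd(1)[OF quotient] by (simp add: M_def mult_ac)

lemma p_dvd_n: "p dvd n"
  by (subst lcm_eq_div_gcd(2)[OF quotient]) simp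

lemma M_eq_div_mult: "M = n div k * (h div gcd h n)"
proof -
  have "n div k = gcd h n * (p * s)"
    using factors_pos by (subst lcm_eq_div_gcd(2)[OF quotient]) simp
  then show ?thesis by (simp add: M_def)
qed

lemma in_decomposition_group:
  assumes "prime q" "q dvd n"
  shows "q dvd M" "Suc (M div p) \<in> decomposition_group q M"
proof -
  show "q dvd M" using prime_dvd_h[OF assms] by (simp add: M_def)
  moreover have "M dvd lcm n h" by (simp add: lcm_eq_mult)
  moreover have "l dvd h" if "prime l" "l dvd M" for l
    using that \<open>M dvd lcm n h\<close> prime_dvd_lcm_imp_dvd_h dvd_trans by blast
  ultimately have "1 + M div p \<in> decomposition_group q M"
    using prime_p assms n_pos h_pos noncong[OF prime_p p_dvd_n assms]
    by (intro one_plus_cofactor_in_decomposition_group[of p q M "lcm n h" h])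
      (auto simp: M_def lcm_pos_nat)
  then show "Suc (M div p) \<in> decomposition_group q M" by simp
qed

lemma cyclotomic_fourier_sum: "cyclotomic_fourier_sum M (n div k) p h (\<lambda>v. c (x + k * v))"
proof
  show "M > 0" using h_pos factors_pos prime_gt_0_nat[OF prime_p] by (simp add: M_def)
  then have "M div (n div k) = h div gcd h n" by (subst M_eq_div_mult) (auto simp: M_eq_div_mult)
  moreover have "coprime p (h div gcd h n)"
    using lcm_eq_div_gcd(3)[OF quotient] by (simp add: coprime_commute)
  ultimately show "coprime p (M div (n div k))" by simp
  show "n div k dvd M" using M_eq_div_mult by (rule dvdI)
  show "l dvd h" if "prime l" "l dvd M" for l
    using that prime_dvd_lcm_imp_dvd_h by (simp add: lcm_eq_mult)
qed (use prime_p root in \<open>auto simp: M_def\<close>)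

lemma concentrated_step:
  assumes "concentrated k"
  shows "concentrated (p * k) \<or> n \<le> (gcd h n)\<^sup>2"
proof -
  obtain x where norm_square: "(norm (fourier (n div k) (\<lambda>v. c (x + k * v))))\<^sup>2 = of_nat n"
    using assms by (auto simp: concentrated_def)
  interpret cyclotomic_fourier_sum M "n div k" p h "\<lambda>v. c (x + k * v)"
    by (rule cyclotomic_fourier_sum)
  show ?thesis
  proof (rule descent[OF n_pos norm_square])
    fix y assume "norm (fourier (n div k div p) (\<lambda>v. c (x + k * (y + p * v))))
      = norm (fourier (n div k) (\<lambda>v. c (x + k * v)))"
    moreover have "n div k div p = n div (p * k)" by (simp add: div_mult2_eq mult.commute)
    ultimately have "(norm (fourier (n div (p * k)) (\<lambda>v. c (x + k * y + p * k * v))))\<^sup>2 = of_nat n"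
      using norm_square by (simp add: algebra_simps)
    then show ?thesis unfolding concentrated_def by blast
  next
    fix eps assume "p = 2" "\<not> 8 dvd M" "eps\<^sup>2 = -1"
      "fourier (n div k) (\<lambda>v. c (x + k * v) * (-1) ^ v) = eps * fourier (n div k) (\<lambda>v. c (x + k * v))"
    then show ?thesis
      using exceptional_le_gcd_square[of k s x eps] lcm_eq_div_gcd(2)[OF quotient] norm_square
        prime_dvd_h[OF prime_p p_dvd_n]
      by (simp add: M_def)
  qed (use in_decomposition_group in blast)
qed

end

lemma concentrated_or_le_gcd_square:
  assumes "k dvd n div gcd h n"
  shows "concentrated k \<or> n \<le> (gcd h n)\<^sup>2"
  using assms
proof (induction k rule: prime_divisors_induct)
  case zero
  have "n div gcd h n > 0" using n_pos by (simp add: div_greater_zero_iff gcd_le2_nat)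
  then show ?case using zero by simp
next
  case (unit k)
  then show ?case using concentrated_1 by simp
next
  case (factor p k)
  obtain s where "n div gcd h n = p * k * s" using factor.prems by (elim dvdE)
  then show ?case
    using concentrated_step[OF factor.hyps(1) _ refl] factor.IH dvd_mult_right[OF factor.prems]
    by blast
qed

lemma le_gcd_square: "n \<le> (gcd h n)\<^sup>2"
proof (cases "concentrated (n div gcd h n)")
  case True
  have "n div (n div gcd h n) = gcd h n" using n_pos by (simp add: div_div_eq_right)
  then show ?thesis using concentrated_imp_le_square[OF True] by simp
next
  case False
  then show ?thesis using concentrated_or_le_gcd_square[of "n div gcd h n"] by simp
qed

end

lemma BH_matrix_integer_mod_group_circulant:
  assumes "BH_matrix (integer_mod_group n) h H" "n > 0" "a \<in> {0..<int n}"
  shows "H a (- int u mod int n) = H ((a + int u) mod int n) 0"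
proof -
  have carrier: "carrier (integer_mod_group n) = {0..<int n}"
    using assms(2) by (simp add: carrier_integer_mod_group)
  have "H ((a + int u mod int n) mod int n) ((- int u mod int n + int u mod int n) mod int n)
      = H a (- int u mod int n)"
    using assms unfolding BH_matrix_def carrier by simp
  moreover have "(- int u mod int n + int u mod int n) mod int n = 0" by (simp add: mod_simps)
  ultimately show ?thesis by (simp add: mod_simps)
qed

lemma BH_matrix_integer_mod_group_imp_bh_sequence:
  assumes "BH_matrix (integer_mod_group n) h H" "n > 0"
  shows "bh_sequence n h (\<lambda>u. H (int u mod int n) 0)"
proof
  have carrier: "carrier (integer_mod_group n) = {0..<int n}"
    using assms(2) by (simp add: carrier_integer_mod_group)
  show "n > 0" by (rule assms(2))
  show "h > 0" using assms(1) by (simp add: BH_matrix_def)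
  show "H (int u mod int n) 0 ^ h = 1" for u
    using assms unfolding BH_matrix_def carrier by simp
  show "H (int (u mod n) mod int n) 0 = H (int u mod int n) 0" for u by (simp add: zmod_int)
  fix d assume "\<not> n dvd d"
  define a where "a = int d mod int n"
  have residue: "a \<in> {0..<int n}" "a \<noteq> 0"
    using assms(2) \<open>\<not> n dvd d\<close> by (auto simp: a_def mod_0_imp_dvd simp flip: int_dvd_int_iff)
  have "(\<Sum>u<n. H (int (u + d) mod int n) 0 * cnj (H (int u mod int n) 0))
      = (\<Sum>u<n. H a (- int u mod int n) * cnj (H 0 (- int u mod int n)))"
    using BH_matrix_integer_mod_group_circulant[OF assms] residue(1) assms(2)
    by (intro sum.cong refl) (simp add: a_def mod_simps add.commute)
  also have "\<dots> = (\<Sum>l\<in>{0..<int n}. H a l * cnj (H 0 l))"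
    by (rule sum.reindex_bij_witness[of _ "\<lambda>l. nat (- l mod int n)" "\<lambda>u. - int u mod int n"])
      (use assms(2) in \<open>auto simp: mod_minus_eq nat_less_iff\<close>)
  also have "\<dots> = 0"
    using assms residue unfolding BH_matrix_def carrier by simp
  finally show "(\<Sum>u<n. H (int (u + d) mod int n) 0 * cnj (H (int u mod int n) 0)) = 0" .
qed

theorem theorem3p2:
  fixes n h m :: nat
  assumes "n > 0" and "h > 0"
    and "m = lcm n h"
    and "\<exists>H. BH_matrix (integer_mod_group n) h H"
    and "\<And>p. prime p \<Longrightarrow> p dvd n \<Longrightarrow> p dvd h"
    and "\<And>p q. prime p \<Longrightarrow> p dvd n \<Longrightarrow> prime q \<Longrightarrow> q dvd n \<Longrightarrow> q \<noteq> p \<Longrightarrow>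
           \<not> [q ^ ord (mtilde m q) q = 1] (mod p ^ (multiplicity p h + 1))"
  shows "n \<le> (gcd h n)\<^sup>2"
proof -
  obtain H where "BH_matrix (integer_mod_group n) h H" using assms(4) by blast
  then interpret bh_sequence n h "\<lambda>u. H (int u mod int n) 0"
    using assms(1) by (rule BH_matrix_integer_mod_group_imp_bh_sequence)
  interpret bh_sequence_field_descent n h "\<lambda>u. H (int u mod int n) 0"
    using assms(3,5,6) by unfold_locales auto
  show ?thesis by (rule le_gcd_square)
qed

end
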